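(* Let $G$ be a bipartite planar graph. Then $\vec{\chi}(G)\le 5$.
   Context: All graphs are finite and simple. An orientation of $G$ chooses a direction for each edge; $d^+(v)$ is the number of edges directed out of $v$. An orientation is proper if $d^+(u)\neq d^+(v)$ for every edge $uv$. The proper orientation number $\vec{\chi}(G)$ is the minimum, over all proper orientations of $G$, of $\max_{v\in V(G)} d^+(v)$ (every graph has a proper orientation). *)

theory Defs
  imports "HOL-Analysis.Analysis"
begin

text \<open>A finite simple graph is given by its vertex set \<open>V\<close> and its set \<open>E\<close> of two-element edges.\<close>

definition finite_simple_graph :: "'a set \<Rightarrow> 'a set set \<Rightarrow> bool" where
  "finite_simple_graph V E \<longleftrightarrow> finite V \<and> (\<forall>e\<in>E. e \<subseteq> V \<and> card e = 2)"

definition bipartite_graph :: "'a set \<Rightarrow> 'a set set \<Rightarrow> bool" where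
  "bipartite_graph V E \<longleftrightarrow>
     (\<exists>X Y. X \<union> Y = V \<and> X \<inter> Y = {} \<and> (\<forall>e\<in>E. \<exists>x\<in>X. \<exists>y\<in>Y. e = {x, y}))"

text \<open>
  Planarity is topological: the plane is the type \<^typ>\<open>complex\<close>, as in the Jordan curve theory of
  the library, and edges are drawn as arbitrary (not necessarily polygonal) arcs. The parametrisation
  of the arc of an edge may run in either direction. The interior of an arc meets neither the image
  of a vertex nor the arc of another edge.
\<close>

definition arc_interior :: "(real \<Rightarrow> 'b::topological_space) \<Rightarrow> 'b set" where
  "arc_interior g = path_image g - {pathstart g, pathfinish g}"

definition plane_drawing ::
  "'a set \<Rightarrow> 'a set set \<Rightarrow> ('a \<Rightarrow> complex) \<Rightarrow> ('a set \<Rightarrow> real \<Rightarrow> complex) \<Rightarrow> bool" where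
  "plane_drawing V E p \<gamma> \<longleftrightarrow>
     inj_on p V \<and>
     (\<forall>e\<in>E. arc (\<gamma> e) \<and> {pathstart (\<gamma> e), pathfinish (\<gamma> e)} = p ` e) \<and>
     (\<forall>e\<in>E. arc_interior (\<gamma> e) \<inter> p ` V = {}) \<and>
     (\<forall>e\<in>E. \<forall>f\<in>E. e \<noteq> f \<longrightarrow> arc_interior (\<gamma> e) \<inter> path_image (\<gamma> f) = {})"

definition planar_graph :: "'a set \<Rightarrow> 'a set set \<Rightarrow> bool" where
  "planar_graph V E \<longleftrightarrow> (\<exists>p \<gamma>. plane_drawing V E p \<gamma>)"

text \<open>\<open>(u, v) \<in> D\<close> means that the edge \<open>{u, v}\<close> is directed from \<open>u\<close> to \<open>v\<close>.\<close>

definition orientation :: "'a set set \<Rightarrow> ('a \<times> 'a) set \<Rightarrow> bool" where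
  "orientation E D \<longleftrightarrow>
     (\<forall>u v. (u, v) \<in> D \<longrightarrow> {u, v} \<in> E) \<and>
     (\<forall>u v. {u, v} \<in> E \<longrightarrow> ((u, v) \<in> D) \<noteq> ((v, u) \<in> D))"

definition outdeg :: "('a \<times> 'a) set \<Rightarrow> 'a \<Rightarrow> nat" where
  "outdeg D v = card {w. (v, w) \<in> D}"

definition proper_orientation :: "'a set set \<Rightarrow> ('a \<times> 'a) set \<Rightarrow> bool" where
  "proper_orientation E D \<longleftrightarrow>
     orientation E D \<and> (\<forall>u v. {u, v} \<in> E \<longrightarrow> outdeg D u \<noteq> outdeg D v)"

text \<open>
  The supremum is a maximum since \<open>V\<close> is finite (and \<open>0\<close> if \<open>V\<close> is empty). The infimum is a
  minimum by well-ordering of \<^typ>\<open>nat\<close>; it ranges over a nonempty set by the lemma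
  \<open>proper_orientation_exists\<close> below.
\<close>

definition proper_orientation_number :: "'a set \<Rightarrow> 'a set set \<Rightarrow> nat" where
  "proper_orientation_number V E =
     (INF D \<in> {D. proper_orientation E D}. SUP v \<in> V. outdeg D v)"

lemma finite_simple_graph_edgeD:
  assumes "finite_simple_graph V E" "{u, v} \<in> E"
  shows "u \<in> V" "v \<in> V" "u \<noteq> v"
  using assms by (auto simp: finite_simple_graph_def card_2_iff)

text \<open>
  Direct all edges at a vertex \<open>x\<close> of maximum degree away from \<open>x\<close> and continue with the graph
  without \<open>x\<close>.
\<close>

lemma proper_orientation_exists:
  assumes "finite_simple_graph V E"
  shows "\<exists>D. proper_orientation E D"
  using assms
proof (induction "card V" arbitrary: V E)
  case 0
  then have "E = {}"
    by (fastforce simp: finite_simple_graph_def)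
  then have "proper_orientation E {}"
    by (simp add: proper_orientation_def orientation_def)
  then show ?case ..
next
  case (Suc n)
  define N where "N v = {w. {v, w} \<in> E}" for v
  have finV: "finite V" using Suc.prems by (simp add: finite_simple_graph_def)
  have NV: "N v \<subseteq> V" for v
    unfolding N_def using finite_simple_graph_edgeD[OF Suc.prems] by blast
  have finN: "finite (N v)" for v using NV finV finite_subset by blast
  have "V \<noteq> {}" using Suc.hyps by auto
  then have "Max ((\<lambda>v. card (N v)) ` V) \<in> (\<lambda>v. card (N v)) ` V"
    using finV by (intro Max_in) auto
  then obtain x where "x \<in> V" "card (N x) = Max ((\<lambda>v. card (N v)) ` V)"
    by force
  with finV have x: "x \<in> V" "\<And>v. v \<in> V \<Longrightarrow> card (N v) \<le> card (N x)"
    by simp_all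
  define F where "F = {e \<in> E. x \<notin> e}"
  have "finite_simple_graph (V - {x}) F"
    using Suc.prems by (auto simp: finite_simple_graph_def F_def)
  moreover have "n = card (V - {x})"
    using Suc.hyps x finV by simp
  ultimately obtain D where D: "proper_orientation F D"
    using Suc.hyps(1) by blast
  have DF: "{u, v} \<in> F" if "(u, v) \<in> D" for u v
    using D that by (auto simp: proper_orientation_def orientation_def)
  define D' where "D' = D \<union> {x} \<times> N x"
  have out_x: "outdeg D' x = card (N x)"
  proof -
    have "{w. (x, w) \<in> D'} = N x" unfolding D'_def using DF F_def by blast
    then show ?thesis by (simp add: outdeg_def)
  qed
  have out_other: "outdeg D' v = outdeg D v" if "v \<noteq> x" for v
    using that by (simp add: outdeg_def D'_def)
  have less: "outdeg D' v < card (N x)" if "{x, v} \<in> E" for v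
  proof -
    have v: "v \<in> V" "v \<noteq> x" using finite_simple_graph_edgeD[OF Suc.prems that] by auto
    have "{w. (v, w) \<in> D} \<subseteq> N v - {x}"
      using DF unfolding F_def N_def by blast
    moreover have "x \<in> N v" using that by (simp add: N_def insert_commute)
    ultimately have "{w. (v, w) \<in> D} \<subset> N v" by blast
    then have "outdeg D v < card (N v)"
      unfolding outdeg_def using finN psubset_card_mono by blast
    then show ?thesis using out_other v x(2)[of v] by simp
  qed
  have "proper_orientation E D'"
    unfolding proper_orientation_def orientation_def
  proof (intro conjI allI impI)
    fix u v assume "(u, v) \<in> D'"
    then show "{u, v} \<in> E" using DF by (auto simp: D'_def F_def N_def)
  next
    fix u v assume e: "{u, v} \<in> E"
    then have ne: "u \<noteq> v" using finite_simple_graph_edgeD[OF Suc.prems] by blast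
    consider "u = x" | "v = x" | "{u, v} \<in> F" using e by (auto simp: F_def)
    then show "((u, v) \<in> D') \<noteq> ((v, u) \<in> D')"
    proof cases
      case 3
      then have "u \<noteq> x" "v \<noteq> x" by (auto simp: F_def)
      with 3 D show ?thesis
        by (auto simp: D'_def proper_orientation_def orientation_def)
    qed (use e ne DF in \<open>auto simp: D'_def N_def F_def insert_commute\<close>)
  next
    fix u v assume e: "{u, v} \<in> E"
    consider "u = x" | "v = x" | "{u, v} \<in> F" using e by (auto simp: F_def)
    then show "outdeg D' u \<noteq> outdeg D' v"
    proof cases
      case 1
      then show ?thesis using less[of v] out_x e by auto
    next
      case 2
      then show ?thesis using less[of u] out_x e by (auto simp: insert_commute)
    next
      case 3
      then have "u \<noteq> x" "v \<noteq> x" by (auto simp: F_def)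
      with 3 D show ?thesis
        using out_other by (auto simp: proper_orientation_def)
    qed
  qed
  then show ?case ..
qed

end

theory Submission
  imports Defs
begin

text \<open>
  The proof joins a fact on plane drawings to a construction for sparse bipartite graphs.

  Every set \<open>W\<close> of vertices of a bipartite planar graph spans at most \<open>2 |W|\<close> edges
  (\<open>bipartite_planar_card_edges_le\<close>), so by Hakimi's theorem the graph has an orientation with all
  outdegrees at most \<open>k = 2\<close> (\<open>orientation_outdeg_le_of_sparse\<close>). From such an orientation, any bipartite
  graph with parts \<open>X\<close> and \<open>Y\<close> gets a proper orientation with outdegrees at most \<open>k + 3\<close>
  (\<open>bipartite_proper_orientation_le\<close>). First, vertices are raised to a fixed high outdegree for as long
  as possible, \<open>k + 3\<close> on \<open>X\<close> and \<open>k + 2\<close> on \<open>Y\<close>, by flipping edges that come from low vertices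
  (\<open>saturated_orientation_exists\<close>). A vertex that cannot be raised has so few low neighbours that the edges
  between low vertices may be oriented freely: a low vertex of \<open>Y\<close> never exceeds \<open>k + 1\<close>, and one of
  \<open>X\<close> never exceeds \<open>k + 2\<close>. A greedy orientation then makes the low part proper, and a refinement of it
  keeps the low vertices of \<open>X\<close> off the value \<open>k + 2\<close> of the raised vertices of \<open>Y\<close>
  (\<open>capped_proper_orientation_exists\<close>).

  The edge bound is the usual consequence of Euler's formula, but the edges are arbitrary arcs. A face is a
  component of the complement of the drawing, and all that is needed about faces follows from the
  Jordan curve theorem, Janiszewski's theorem and the fact that no arc separates the plane: an
  arc that joins two points of one component of the drawing adds a face (\<open>face_lower_bound\<close>), an edge
  bounds at most two faces (\<open>edge_bounds_at_most_two_faces\<close>), and fewer than four edges of a bipartite graph do not enclose a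
  face (\<open>card_boundary_edges_ge_4\<close>).
\<close>

section \<open>Orientations with small outdegrees\<close>

abbreviation nbrs :: "'a set set \<Rightarrow> 'a \<Rightarrow> 'a set" where
  "nbrs E v \<equiv> {w. {v, w} \<in> E}"

lemma nbrs_finite:
  assumes "finite_simple_graph V E"
  shows "nbrs E v \<subseteq> V" "finite (nbrs E v)"
proof -
  show "nbrs E v \<subseteq> V"
    using finite_simple_graph_edgeD[OF assms] by blast
  then show "finite (nbrs E v)"
    using assms finite_subset unfolding finite_simple_graph_def by blast
qed

lemma orientation_out_subset_nbrs:
  assumes "orientation E D"
  shows "{w. (v, w) \<in> D} \<subseteq> nbrs E v"
  using assms by (auto simp: orientation_def)

lemma outdeg_le_card_nbrs:
  assumes "finite_simple_graph V E" "orientation E D"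
  shows "outdeg D v \<le> card (nbrs E v)"
  unfolding outdeg_def
  using orientation_out_subset_nbrs[OF assms(2)] nbrs_finite(2)[OF assms(1)]
  by (intro card_mono)

lemma orientation_asym:
  assumes "orientation E D" "(u, v) \<in> D"
  shows "(v, u) \<notin> D"
  using assms unfolding orientation_def by blast

lemma orientation_finite:
  assumes "finite_simple_graph V E" "orientation E D"
  shows "D \<subseteq> V \<times> V" "finite D" "finite {w. (v, w) \<in> D}"
proof -
  show *: "D \<subseteq> V \<times> V"
    using assms finite_simple_graph_edgeD[OF assms(1)] by (fastforce simp: orientation_def)
  then show "finite D"
    using assms(1) finite_subset unfolding finite_simple_graph_def by blast
  show "finite {w. (v, w) \<in> D}"
    using orientation_out_subset_nbrs[OF assms(2)] nbrs_finite(2)[OF assms(1)] finite_subset by blast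
qed

text \<open>
  Cut the path at its last visit to the start. This makes reachability usable as a substitute for
  simple paths: the rest of the path lives in a smaller set.
\<close>

lemma rtrancl_avoiding_start:
  assumes "(u, w) \<in> r\<^sup>*" "u \<noteq> w"
  shows "\<exists>u'. (u, u') \<in> r \<and> u' \<noteq> u \<and> (u', w) \<in> (r \<inter> (- {u}) \<times> (- {u}))\<^sup>*"
  using assms
proof (induction rule: rtrancl_induct)
  case (step y z)
  show ?case
  proof (cases "u = y")
    case False
    then obtain u' where u': "(u, u') \<in> r" "u' \<noteq> u" "(u', y) \<in> (r \<inter> (- {u}) \<times> (- {u}))\<^sup>*"
      using step by blast
    have "(y, z) \<in> r \<inter> (- {u}) \<times> (- {u})" using False step by auto
    with u' show ?thesis by (meson rtrancl.rtrancl_into_rtrancl)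
  qed (use step in auto)
qed simp

lemma orientation_flip:
  assumes "orientation E D" "(u, v) \<in> D" "u \<noteq> v"
  shows "orientation E (insert (v, u) (D - {(u, v)}))"
proof -
  have 1: "{a, b} \<in> E" if "(a, b) \<in> D" for a b
    using assms(1) that unfolding orientation_def by blast
  have 2: "((a, b) \<in> D) \<noteq> ((b, a) \<in> D)" if "{a, b} \<in> E" for a b
    using assms(1) that unfolding orientation_def by blast
  have "{v, u} \<in> E" "(v, u) \<notin> D"
    using 1[OF assms(2)] 2[of u v] assms(2) by (auto simp: insert_commute)
  with assms(2,3) 1 2 show ?thesis
    unfolding orientation_def by auto
qed

lemma outdeg_flip:
  assumes "finite_simple_graph V E" "orientation E D" "(u, v) \<in> D"
  defines "D' \<equiv> insert (v, u) (D - {(u, v)})"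
  shows "outdeg D' u + 1 = outdeg D u" "outdeg D' v = outdeg D v + 1"
    "\<And>z. z \<noteq> u \<Longrightarrow> z \<noteq> v \<Longrightarrow> outdeg D' z = outdeg D z"
proof -
  have "{u, v} \<in> E" using assms by (auto simp: orientation_def)
  then have ne: "u \<noteq> v" using finite_simple_graph_edgeD[OF assms(1)] by blast
  have no: "(v, u) \<notin> D" using assms orientation_asym by metis
  have "{w. (u, w) \<in> D'} = {w. (u, w) \<in> D} - {v}" using ne by (auto simp: D'_def)
  then show "outdeg D' u + 1 = outdeg D u"
    using orientation_finite(3)[OF assms(1,2), of u] assms(3)
    unfolding outdeg_def by (metis Suc_eq_plus1 mem_Collect_eq card_Suc_Diff1)
  have "{w. (v, w) \<in> D'} = insert u {w. (v, w) \<in> D}" using ne by (auto simp: D'_def)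
  then show "outdeg D' v = outdeg D v + 1"
    using orientation_finite(3)[OF assms(1,2), of v] no by (simp add: outdeg_def)
  show "outdeg D' z = outdeg D z" if "z \<noteq> u" "z \<noteq> v" for z
    using that by (simp add: outdeg_def D'_def)
qed

text \<open>
  Reversing a directed path moves one unit of outdegree from its start \<open>u\<close> to its end \<open>w\<close>. The
  induction removes \<open>u\<close> from the set \<open>A\<close> in which the path may run; since the induction hypothesis
  changes \<open>D\<close> only inside the smaller set, the first edge of the path is still present and can be
  flipped last.
\<close>

lemma path_reversal:
  assumes G: "finite_simple_graph V E" and "finite A" "orientation E D"
    "(u, w) \<in> (D \<inter> A \<times> A)\<^sup>*" "u \<noteq> w"
  shows "\<exists>D'. orientation E D' \<and> (\<forall>e. e \<notin> A \<times> A \<longrightarrow> e \<in> D' \<longleftrightarrow> e \<in> D) \<and>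
    outdeg D' u + 1 = outdeg D u \<and> outdeg D' w = outdeg D w + 1 \<and>
    (\<forall>z. z \<noteq> u \<longrightarrow> z \<noteq> w \<longrightarrow> outdeg D' z = outdeg D z)"
  using assms(2-)
proof (induction "card A" arbitrary: A u)
  case 0
  then show ?case by (auto elim: converse_rtranclE)
next
  case (Suc n)
  obtain u' where u': "(u, u') \<in> D \<inter> A \<times> A" "u' \<noteq> u"
    and w: "(u', w) \<in> (D \<inter> A \<times> A \<inter> (- {u}) \<times> (- {u}))\<^sup>*"
    using rtrancl_avoiding_start[OF Suc.prems(3,4)] by blast
  have uA: "u \<in> A" using u' by blast
  have eq: "D \<inter> A \<times> A \<inter> (- {u}) \<times> (- {u}) = D \<inter> (A - {u}) \<times> (A - {u})" by auto
  have w: "(u', w) \<in> (D \<inter> (A - {u}) \<times> (A - {u}))\<^sup>*" using w unfolding eq .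
  show ?case
  proof (cases "u' = w")
    case True
    let ?D = "insert (w, u) (D - {(u, w)})"
    have "(u, w) \<in> D" using u' True by blast
    then show ?thesis
      using orientation_flip[OF Suc.prems(2)] outdeg_flip[OF G Suc.prems(2)] Suc.prems(4) u' True
      by (intro exI[of _ ?D]) auto
  next
    case False
    have "n = card (A - {u})" using Suc uA by simp
    then obtain D1 where D1: "orientation E D1"
      "\<forall>e. e \<notin> (A - {u}) \<times> (A - {u}) \<longrightarrow> e \<in> D1 \<longleftrightarrow> e \<in> D"
      "outdeg D1 u' + 1 = outdeg D u'" "outdeg D1 w = outdeg D w + 1"
      "\<forall>z. z \<noteq> u' \<longrightarrow> z \<noteq> w \<longrightarrow> outdeg D1 z = outdeg D z"
      using Suc.hyps(1)[of "A - {u}" u'] Suc.prems w False by auto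
    \<comment> \<open>The vertex \<open>u'\<close> lost one out-edge in \<open>D1\<close> and regains it here.\<close>
    let ?D = "insert (u', u) (D1 - {(u, u')})"
    have uu: "(u, u') \<in> D1" using D1(2) u' by auto
    show ?thesis
    proof (intro exI[of _ ?D] conjI)
      show "orientation E ?D" using orientation_flip[OF D1(1) uu] u' by auto
      show "\<forall>e. e \<notin> A \<times> A \<longrightarrow> (e \<in> ?D) = (e \<in> D)" using D1(2) u' by auto
      note o = outdeg_flip[OF G D1(1) uu]
      show "outdeg ?D u + 1 = outdeg D u" using o(1) D1(5) u' Suc.prems(4) by auto
      show "outdeg ?D w = outdeg D w + 1" using o(3)[of w] False Suc.prems(4) D1(4) by auto
      show "\<forall>z. z \<noteq> u \<longrightarrow> z \<noteq> w \<longrightarrow> outdeg ?D z = outdeg D z"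
      proof (intro allI impI)
        fix z assume "z \<noteq> u" "z \<noteq> w"
        then show "outdeg ?D z = outdeg D z"
          using o(2,3) D1(3,5) by (cases "z = u'") auto
      qed
    qed
  qed
qed

text \<open>
  Hakimi's theorem. In an orientation with least total excess over \<open>k\<close>, let \<open>R\<close> be the set reachable
  from a vertex \<open>v\<close> with outdegree above \<open>k\<close>. All edges leaving vertices of \<open>R\<close> stay in \<open>R\<close>, so by sparsity
  some vertex of \<open>R\<close> has outdegree below \<open>k\<close>, and reversing a path to it lowers the excess.
\<close>

lemma orientation_outdeg_le_of_sparse:
  fixes k :: nat
  assumes G: "finite_simple_graph V E"
    and sparse: "\<And>W. W \<subseteq> V \<Longrightarrow> card {e \<in> E. e \<subseteq> W} \<le> k * card W"
  shows "\<exists>D. orientation E D \<and> (\<forall>v\<in>V. outdeg D v \<le> k)"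
proof -
  define excess where "excess D = (\<Sum>v\<in>V. outdeg D v - k)" for D
  have finV: "finite V" using G by (simp add: finite_simple_graph_def)
  obtain D0 where "orientation E D0"
    using proper_orientation_exists[OF G] by (auto simp: proper_orientation_def)
  then obtain D where D: "orientation E D" and
    min: "\<And>D'. orientation E D' \<Longrightarrow> excess D \<le> excess D'"
    using ex_has_least_nat[of "orientation E" D0 excess] by blast
  have "outdeg D v \<le> k" if v: "v \<in> V" for v
  proof (rule ccontr)
    assume big: "\<not> outdeg D v \<le> k"
    define R where "R = {w. (v, w) \<in> D\<^sup>*}"
    have DV: "D \<subseteq> V \<times> V" by (rule orientation_finite(1)[OF G D])
    have RV: "R \<subseteq> V"
    proof
      fix w assume "w \<in> R"
      then have "(v, w) \<in> D\<^sup>*" by (simp add: R_def)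
      then show "w \<in> V" using v DV by (cases rule: rtranclE) auto
    qed
    then have finR: "finite R" using finV finite_subset by blast
    have vR: "v \<in> R" by (simp add: R_def)
    show False
    proof (cases "\<forall>w\<in>R. k \<le> outdeg D w")
      case True
      define P where "P = Sigma R (\<lambda>u. {w. (u, w) \<in> D})"
      have finP: "finite P"
        unfolding P_def using finR orientation_finite(3)[OF G D] by blast
      have "k * card R < (\<Sum>w\<in>R. outdeg D w)"
      proof -
        have "(\<Sum>w\<in>R. k) < (\<Sum>w\<in>R. outdeg D w)"
          using True vR big finR by (intro sum_strict_mono_ex1) (auto simp: not_le)
        then show ?thesis by (simp add: mult.commute)
      qed
      also have "\<dots> = card P"
        unfolding P_def outdeg_def using finR orientation_finite(3)[OF G D]
        by (subst card_SigmaI) auto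
      also have "\<dots> \<le> card {e \<in> E. e \<subseteq> R}"
      proof (rule card_inj_on_le[of "\<lambda>(u, w). {u, w}"])
        show "inj_on (\<lambda>(u, w). {u, w}) P"
          using orientation_asym[OF D] by (auto simp: inj_on_def P_def doubleton_eq_iff)
        show "(\<lambda>(u, w). {u, w}) ` P \<subseteq> {e \<in> E. e \<subseteq> R}"
          using D by (auto simp: P_def R_def orientation_def)
        have "E \<subseteq> Pow V" using G by (auto simp: finite_simple_graph_def)
        then show "finite {e \<in> E. e \<subseteq> R}" using finV finite_subset by fastforce
      qed
      finally show False using sparse[OF RV] by simp
    next
      case False
      then obtain w where w: "w \<in> R" "outdeg D w < k" by auto
      have "(v, w) \<in> (D \<inter> V \<times> V)\<^sup>*" using w DV by (simp add: R_def Int_absorb2)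
      moreover have ne: "v \<noteq> w" using w big by auto
      ultimately obtain D' where D': "orientation E D'"
        "outdeg D' v + 1 = outdeg D v" "outdeg D' w = outdeg D w + 1"
        "\<forall>z. z \<noteq> v \<longrightarrow> z \<noteq> w \<longrightarrow> outdeg D' z = outdeg D z"
        using path_reversal[OF G finV D] by blast
      have "excess D' < excess D"
        unfolding excess_def
      proof (rule sum_strict_mono_ex1[OF finV])
        show "\<forall>x\<in>V. outdeg D' x - k \<le> outdeg D x - k"
        proof
          fix x show "outdeg D' x - k \<le> outdeg D x - k"
            using D'(2-) w(2) by (cases "x = v"; cases "x = w") auto
        qed
        show "\<exists>x\<in>V. outdeg D' x - k < outdeg D x - k"
          using v D'(2) big by (intro bexI[of _ v]) auto
      qed
      then show False using min[OF D'(1)] by simp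
    qed
  qed
  with D show ?thesis by blast
qed

section \<open>Proper orientations with prescribed initial weights\<close>

text \<open>
  Deleting an independent set \<open>B\<close> and later directing all its edges outwards gives the vertices of
  \<open>B\<close> their full degree as outdegree and does not disturb the others: this is how vertices are peeled
  off in the two constructions below.
\<close>

lemma orient_away_from_independent:
  assumes G: "finite_simple_graph V E"
    and indep: "\<forall>e\<in>E. \<not> e \<subseteq> B"
    and D: "orientation {e \<in> E. e \<inter> B = {}} D"
  defines "D' \<equiv> D \<union> (SIGMA b:B. nbrs E b)"
  shows "orientation E D'"
    and "\<And>b. b \<in> B \<Longrightarrow> outdeg D' b = card (nbrs E b)"
    and "\<And>v. v \<notin> B \<Longrightarrow> outdeg D' v = outdeg D v"
proof -
  have D1: "{a, b} \<in> E" "a \<notin> B" "b \<notin> B" if "(a, b) \<in> D" for a b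
  proof -
    have "{a, b} \<in> {e \<in> E. e \<inter> B = {}}" using D that unfolding orientation_def by blast
    then show "{a, b} \<in> E" "a \<notin> B" "b \<notin> B" by simp_all
  qed
  have D2: "((a, b) \<in> D) \<noteq> ((b, a) \<in> D)" if "{a, b} \<in> E" "a \<notin> B" "b \<notin> B" for a b
  proof -
    have "{a, b} \<in> {e \<in> E. e \<inter> B = {}}" using that by simp
    then show ?thesis using D unfolding orientation_def by blast
  qed
  show "orientation E D'"
    unfolding orientation_def
  proof (intro conjI allI impI)
    show "{u, v} \<in> E" if "(u, v) \<in> D'" for u v
      using that D1 by (auto simp: D'_def)
    fix u v assume e: "{u, v} \<in> E"
    then have e': "{v, u} \<in> E" by (simp add: insert_commute)
    have "\<not> (u \<in> B \<and> v \<in> B)" using indep e by auto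
    then show "((u, v) \<in> D') \<noteq> ((v, u) \<in> D')"
      using D1(2,3) D2[OF e] e e' unfolding D'_def by blast
  qed
  have "{w. (b, w) \<in> D'} = nbrs E b" if "b \<in> B" for b
    using D1 that by (auto simp: D'_def)
  then show "outdeg D' b = card (nbrs E b)" if "b \<in> B" for b
    using that by (simp add: outdeg_def)
  show "outdeg D' v = outdeg D v" if "v \<notin> B" for v
    using that by (simp add: outdeg_def D'_def)
qed

lemma card_nbrs_mono:
  assumes "finite_simple_graph V E" "F \<subseteq> E"
  shows "card (nbrs F v) \<le> card (nbrs E v)"
  using assms(2) nbrs_finite(2)[OF assms(1)] by (intro card_mono) auto

lemma card_nbrs_less:
  assumes "finite_simple_graph V E" "F \<subseteq> E" "{v, w} \<in> E" "{v, w} \<notin> F"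
  shows "card (nbrs F v) < card (nbrs E v)"
  using assms nbrs_finite(2)[OF assms(1)] by (intro psubset_card_mono) auto

text \<open>
  The weight \<open>h v\<close> counts edges at \<open>v\<close> that are already directed outwards. The greedy argument for
  unweighted graphs still works: a vertex \<open>x\<close> with the largest possible final value takes all its
  edges, which pushes every neighbour strictly below that value.
\<close>

lemma weighted_proper_orientation_exists:
  fixes h :: "'a \<Rightarrow> nat"
  assumes "finite_simple_graph V E"
  shows "\<exists>D. orientation E D \<and> (\<forall>u v. {u, v} \<in> E \<longrightarrow> h u + outdeg D u \<noteq> h v + outdeg D v)"
  using assms
proof (induction "card V" arbitrary: V E)
  case 0
  then have "E = {}"
    by (fastforce simp: finite_simple_graph_def)
  then have "orientation E {}"
    by (simp add: orientation_def)
  with \<open>E = {}\<close> show ?case by blast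
next
  case (Suc n)
  note G = Suc.prems
  define pot where "pot v = h v + card (nbrs E v)" for v
  have finV: "finite V" and "V \<noteq> {}" using G Suc.hyps by (auto simp: finite_simple_graph_def)
  then have "Max (pot ` V) \<in> pot ` V" by (intro Max_in) auto
  then obtain x where "x \<in> V" "pot x = Max (pot ` V)" by force
  with finV have x: "x \<in> V" "\<And>v. v \<in> V \<Longrightarrow> pot v \<le> pot x" by simp_all
  let ?F = "{e \<in> E. e \<inter> {x} = {}}"
  have F: "finite_simple_graph (V - {x}) ?F"
    using G by (auto simp: finite_simple_graph_def)
  moreover have "n = card (V - {x})" using Suc.hyps x finV by simp
  ultimately obtain D where D: "orientation ?F D"
    and dist: "\<And>u v. {u, v} \<in> ?F \<Longrightarrow> h u + outdeg D u \<noteq> h v + outdeg D v"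
    using Suc.hyps(1)[of "V - {x}" ?F] by auto
  define D' where "D' = D \<union> (SIGMA b:{x}. nbrs E b)"
  have indep: "\<forall>e\<in>E. \<not> e \<subseteq> {x}"
    using G by (auto simp: finite_simple_graph_def card_2_iff)
  note D' = orient_away_from_independent[OF G indep D, folded D'_def]
  have out_x: "h x + outdeg D' x = pot x" using D'(2)[of x] x by (simp add: pot_def)
  have less: "h v + outdeg D' v < pot x" if e: "{x, v} \<in> E" for v
  proof -
    have v: "v \<in> V" "v \<noteq> x" using finite_simple_graph_edgeD[OF G e] by auto
    have "outdeg D' v \<le> card (nbrs ?F v)"
      using D'(3)[of v] v outdeg_le_card_nbrs[OF F D, of v] by simp
    also have "\<dots> < card (nbrs E v)"
      using e by (intro card_nbrs_less[OF G, where w = x]) (auto simp: insert_commute)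
    finally show ?thesis using x(2)[OF v(1)] by (simp add: pot_def)
  qed
  have "h u + outdeg D' u \<noteq> h v + outdeg D' v" if e: "{u, v} \<in> E" for u v
  proof -
    consider "u = x" | "v = x" | "{u, v} \<in> ?F" using e by auto
    then show ?thesis
    proof cases
      case 1
      then show ?thesis using less[of v] out_x e by auto
    next
      case 2
      then show ?thesis using less[of u] out_x e by (auto simp: insert_commute)
    next
      case 3
      then show ?thesis using dist[OF 3] D'(3)[of u] D'(3)[of v] x by auto
    qed
  qed
  with D'(1) x show ?case by blast
qed

text \<open>
  Here the largest possible final value \<open>h + degree\<close> is at most \<open>m\<close> on \<open>Y\<close> but may be \<open>m + 1\<close> at some
  vertices of \<open>X\<close>, called critical here, and these must be kept from reaching it. A vertex that
  receives the value \<open>m\<close> causes no conflict once all its neighbours are bound to stay below \<open>m\<close>.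

  If a critical \<open>x\<close> has a neighbour \<open>y\<close> that cannot reach \<open>m\<close>, then direct \<open>y\<close> to \<open>x\<close> and the other edges
  of \<open>x\<close> outwards: \<open>x\<close> has value \<open>m\<close>, and its neighbours stay below \<open>m\<close>. If some \<open>x\<close> can reach exactly \<open>m\<close>,
  it takes all its edges. Otherwise every neighbour of a critical vertex can reach \<open>m\<close>, and all
  vertices of \<open>Y\<close> that can do so take all their edges at once. This leaves a critical \<open>x\<close> with its
  weight \<open>h x < m\<close> and every other vertex of \<open>X\<close> below \<open>m\<close> anyway; the remaining graph is handled greedily.
\<close>

lemma capped_proper_orientation_exists:
  fixes h :: "'a \<Rightarrow> nat" and m :: nat
  assumes "finite_simple_graph V E"
    and "V = X \<union> Y" "X \<inter> Y = {}" "\<And>e. e \<in> E \<Longrightarrow> \<exists>x\<in>X. \<exists>y\<in>Y. e = {x, y}"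
    and "\<And>y. y \<in> Y \<Longrightarrow> h y + card (nbrs E y) \<le> m"
    and "\<And>x. x \<in> X \<Longrightarrow> h x + card (nbrs E x) \<le> m \<or>
      (h x + card (nbrs E x) = m + 1 \<and> h x < m)"
  shows "\<exists>D. orientation E D \<and>
    (\<forall>u v. {u, v} \<in> E \<longrightarrow> h u + outdeg D u \<noteq> h v + outdeg D v) \<and>
    (\<forall>x\<in>X. h x + outdeg D x \<le> m)"
  using assms
proof (induction "card X" arbitrary: V X E h)
  case (0 X V E h)
  have finX: "finite X" using 0 by (auto simp: finite_simple_graph_def)
  then have "X = {}" using 0 by simp
  then have "E = {}" using 0 by fastforce
  then have "orientation E {}" by (simp add: orientation_def)
  with \<open>E = {}\<close> \<open>X = {}\<close> show ?case by blast
next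
  case (Suc n X V E h)
  note G = \<open>finite_simple_graph V E\<close> and VXY = \<open>V = X \<union> Y\<close> \<open>X \<inter> Y = {}\<close>
    and bip = Suc.prems(4) and hY = Suc.prems(5) and hX = Suc.prems(6)
  define pot where "pot v = h v + card (nbrs E v)" for v
  have finX: "finite X" using G VXY by (auto simp: finite_simple_graph_def)
  have XY: "v \<in> Y" if "{x, v} \<in> E" "x \<in> X" for x v
    using bip[OF that(1)] that(2) VXY by (auto simp: doubleton_eq_iff)
  have indepX: "\<not> e \<subseteq> B" if "e \<in> E" "B \<subseteq> X" for e B
    using bip[OF that(1)] that(2) VXY by auto
  have indepY: "\<not> e \<subseteq> B" if "e \<in> E" "B \<subseteq> Y" for e B
    using bip[OF that(1)] that(2) VXY by auto
  consider (pick) x y where "x \<in> X" "pot x = m + 1" "{x, y} \<in> E" "pot y < m"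
    | (top) x where "x \<in> X" "pot x = m"
    | (last) "\<And>x. x \<in> X \<Longrightarrow> pot x < m \<or> pot x = m + 1 \<and> h x < m \<and> (\<forall>y. {x, y} \<in> E \<longrightarrow> pot y = m)"
  proof -
    have "pot x < m \<or> pot x = m + 1 \<and> h x < m \<and> (\<forall>y. {x, y} \<in> E \<longrightarrow> pot y = m)"
      if "\<not> (\<exists>x y. x \<in> X \<and> pot x = m + 1 \<and> {x, y} \<in> E \<and> pot y < m)"
        "\<not> (\<exists>x. x \<in> X \<and> pot x = m)" "x \<in> X" for x
    proof -
      have "pot y = m" if "{x, y} \<in> E" "pot x = m + 1" for y
      proof -
        have "pot y \<le> m" using hY[OF XY[OF that(1) \<open>x \<in> X\<close>]] by (simp add: pot_def)
        moreover have "\<not> pot y < m" using \<open>\<not> (\<exists>x y. x \<in> X \<and> pot x = m + 1 \<and> {x, y} \<in> E \<and> pot y < m)\<close>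
            that \<open>x \<in> X\<close> by blast
        ultimately show ?thesis by simp
      qed
      moreover have "pot x \<noteq> m" using that by blast
      ultimately show ?thesis using hX[OF \<open>x \<in> X\<close>] by (auto simp: pot_def)
    qed
    then show ?thesis using that by blast
  qed
  then show ?case
  proof cases
    case pick
    have yY: "y \<in> Y" using XY pick by blast
    have xy: "x \<noteq> y" using finite_simple_graph_edgeD[OF G pick(3)] by blast
    let ?F = "{e \<in> E. e \<inter> {x} = {}}"
    let ?E = "E - {{x, y}}"
    let ?h = "h(y := h y + 1)"
    have F: "finite_simple_graph (V - {x}) ?F"
      using G by (auto simp: finite_simple_graph_def)
    have E1: "finite_simple_graph V ?E"
      using G by (auto simp: finite_simple_graph_def)
    have Fle: "card (nbrs ?F v) \<le> card (nbrs E v)" for v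
      by (rule card_nbrs_mono[OF G]) auto
    have Fless: "card (nbrs ?F v) < card (nbrs E v)" if "{x, v} \<in> E" for v
      using that by (intro card_nbrs_less[OF G, where w = x]) (auto simp: insert_commute)
    have potF: "?h v + card (nbrs ?F v) < m" if "{x, v} \<in> E" for v
    proof (cases "v = y")
      case True
      then show ?thesis using Fless[OF pick(3)] pick(4) by (simp add: pot_def)
    next
      case False
      then show ?thesis using Fless[OF that] hY[OF XY[OF that pick(1)]] by simp
    qed
    have "\<exists>D. orientation ?F D \<and>
      (\<forall>u v. {u, v} \<in> ?F \<longrightarrow> ?h u + outdeg D u \<noteq> ?h v + outdeg D v) \<and>
      (\<forall>x\<in>X - {x}. ?h x + outdeg D x \<le> m)"
    proof (rule Suc.hyps(1)[where V = "V - {x}"])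
      show "n = card (X - {x})" using Suc.hyps(2) pick(1) finX by simp
      show "finite_simple_graph (V - {x}) ?F" by (rule F)
      show "V - {x} = X - {x} \<union> Y" "(X - {x}) \<inter> Y = {}" using VXY pick(1) by auto
      show "\<exists>x\<in>X - {x}. \<exists>y\<in>Y. e = {x, y}" if "e \<in> ?F" for e
        using that bip[of e] by fastforce
      show "?h y' + card (nbrs ?F y') \<le> m" if "y' \<in> Y" for y'
      proof (cases "y' = y")
        case True
        then show ?thesis using potF[OF pick(3)] by simp
      next
        case False
        then show ?thesis using hY[OF that] Fle[of y'] by simp
      qed
      show "?h x' + card (nbrs ?F x') \<le> m \<or> ?h x' + card (nbrs ?F x') = m + 1 \<and> ?h x' < m"
        if "x' \<in> X - {x}" for x'
      proof -
        have "x' \<noteq> y" using that yY VXY by auto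
        then show ?thesis using hX[of x'] that Fle[of x'] by auto
      qed
    qed
    then obtain D where D: "orientation ?F D"
      and dist: "\<And>u v. {u, v} \<in> ?F \<Longrightarrow> ?h u + outdeg D u \<noteq> ?h v + outdeg D v"
      and DX: "\<And>x'. x' \<in> X - {x} \<Longrightarrow> ?h x' + outdeg D x' \<le> m"
      by blast
    have "?F = {e \<in> ?E. e \<inter> {x} = {}}" by auto
    then have D_E: "orientation {e \<in> ?E. e \<inter> {x} = {}} D" using D by simp
    define D1 where "D1 = D \<union> (SIGMA b:{x}. nbrs ?E b)"
    have ind: "\<forall>e\<in>?E. \<not> e \<subseteq> {x}" using indepX[of _ "{x}"] pick(1) by auto
    note D1 = orient_away_from_independent[OF E1 ind D_E, folded D1_def]
    have o1: "orientation ?E D1" by (rule D1(1))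
    define D2 where "D2 = insert (y, x) D1"
    have D1E: "{a, b} \<in> ?E" if "(a, b) \<in> D1" for a b
      using o1 that unfolding orientation_def by blast
    have yx: "(y, x) \<notin> D1" "(x, y) \<notin> D1" using D1E[of y x] D1E[of x y] by (auto simp: insert_commute)
    have o2: "orientation E D2"
      unfolding orientation_def
    proof (intro conjI allI impI)
      show "{u, v} \<in> E" if "(u, v) \<in> D2" for u v
        using that D1E pick(3) by (auto simp: D2_def insert_commute)
      fix u v assume e: "{u, v} \<in> E"
      show "((u, v) \<in> D2) \<noteq> ((v, u) \<in> D2)"
      proof (cases "{u, v} = {x, y}")
        case True
        then show ?thesis using yx xy by (auto simp: D2_def doubleton_eq_iff)
      next
        case False
        then have "((u, v) \<in> D1) \<noteq> ((v, u) \<in> D1)" using o1 e unfolding orientation_def by blast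
        then show ?thesis using False by (auto simp: D2_def doubleton_eq_iff)
      qed
    qed
    have "nbrs ?E x = nbrs E x - {y}" by (auto simp: doubleton_eq_iff)
    then have "card (nbrs ?E x) + 1 = card (nbrs E x)"
      using nbrs_finite(2)[OF G, of x] pick(3) by (metis Suc_eq_plus1 mem_Collect_eq card_Suc_Diff1)
    moreover have "outdeg D2 x = outdeg D1 x" using xy by (simp add: D2_def outdeg_def)
    ultimately have out_x: "h x + outdeg D2 x = m"
      using D1(2)[of x] pick(1,2) VXY by (auto simp: pot_def)
    have out: "h v + outdeg D2 v = ?h v + outdeg D v" if "v \<noteq> x" for v
    proof (cases "v = y")
      case True
      have "{w. (y, w) \<in> D2} = insert x {w. (y, w) \<in> D1}" by (auto simp: D2_def)
      then have "outdeg D2 y = outdeg D1 y + 1"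
        using yx orientation_finite(3)[OF E1 o1, of y] by (simp add: outdeg_def)
      then show ?thesis using True D1(3)[of v] that pick(1) VXY by auto
    next
      case False
      then have "outdeg D2 v = outdeg D1 v" by (simp add: D2_def outdeg_def)
      then show ?thesis using False D1(3)[of v] that pick(1) VXY by auto
    qed
    have less: "h v + outdeg D2 v < m" if "{x, v} \<in> E" for v
    proof -
      have "v \<noteq> x" using finite_simple_graph_edgeD[OF G that] by blast
      then show ?thesis using out[of v] potF[OF that] outdeg_le_card_nbrs[OF F D, of v] by simp
    qed
    have "h u + outdeg D2 u \<noteq> h v + outdeg D2 v" if e: "{u, v} \<in> E" for u v
    proof -
      consider "u = x" | "v = x" | "{u, v} \<in> ?F" "u \<noteq> x" "v \<noteq> x" using e by auto
      then show ?thesis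
      proof cases
        case 1
        then show ?thesis using less[of v] out_x e by auto
      next
        case 2
        then show ?thesis using less[of u] out_x e by (auto simp: insert_commute)
      next
        case 3
        then show ?thesis using dist[OF 3(1)] out[of u] out[of v] by simp
      qed
    qed
    moreover have "h x' + outdeg D2 x' \<le> m" if "x' \<in> X" for x'
      using DX[of x'] out[of x'] out_x that by (cases "x' = x") auto
    ultimately show ?thesis using o2 by blast
  next
    case top
    let ?F = "{e \<in> E. e \<inter> {x} = {}}"
    have F: "finite_simple_graph (V - {x}) ?F"
      using G by (auto simp: finite_simple_graph_def)
    have Fle: "card (nbrs ?F v) \<le> card (nbrs E v)" for v
      by (rule card_nbrs_mono[OF G]) auto
    have "\<exists>D. orientation ?F D \<and>
      (\<forall>u v. {u, v} \<in> ?F \<longrightarrow> h u + outdeg D u \<noteq> h v + outdeg D v) \<and>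
      (\<forall>x\<in>X - {x}. h x + outdeg D x \<le> m)"
    proof (rule Suc.hyps(1)[where V = "V - {x}"])
      show "n = card (X - {x})" using Suc.hyps(2) top(1) finX by simp
      show "finite_simple_graph (V - {x}) ?F" by (rule F)
      show "V - {x} = X - {x} \<union> Y" "(X - {x}) \<inter> Y = {}" using VXY top(1) by auto
      show "\<exists>x\<in>X - {x}. \<exists>y\<in>Y. e = {x, y}" if "e \<in> ?F" for e
        using that bip[of e] by fastforce
      show "h y + card (nbrs ?F y) \<le> m" if "y \<in> Y" for y
        using hY[OF that] Fle[of y] by simp
      show "h x' + card (nbrs ?F x') \<le> m \<or> h x' + card (nbrs ?F x') = m + 1 \<and> h x' < m"
        if "x' \<in> X - {x}" for x'
        using hX[of x'] that Fle[of x'] by auto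
    qed
    then obtain D where D: "orientation ?F D"
      and dist: "\<And>u v. {u, v} \<in> ?F \<Longrightarrow> h u + outdeg D u \<noteq> h v + outdeg D v"
      and DX: "\<And>x'. x' \<in> X - {x} \<Longrightarrow> h x' + outdeg D x' \<le> m"
      by blast
    define D1 where "D1 = D \<union> (SIGMA b:{x}. nbrs E b)"
    have ind: "\<forall>e\<in>E. \<not> e \<subseteq> {x}" using indepX[of _ "{x}"] top(1) by auto
    note D1 = orient_away_from_independent[OF G ind D, folded D1_def]
    have out_x: "h x + outdeg D1 x = m" using D1(2) top(2) by (simp add: pot_def)
    have less: "h v + outdeg D1 v < m" if "{x, v} \<in> E" for v
    proof -
      have "v \<noteq> x" using finite_simple_graph_edgeD[OF G that] by blast
      then have "outdeg D1 v \<le> card (nbrs ?F v)"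
        using D1(3)[of v] outdeg_le_card_nbrs[OF F D, of v] by simp
      also have "\<dots> < card (nbrs E v)"
        using that by (intro card_nbrs_less[OF G, where w = x]) (auto simp: insert_commute)
      finally show ?thesis using hY[OF XY[OF that top(1)]] by simp
    qed
    have "h u + outdeg D1 u \<noteq> h v + outdeg D1 v" if e: "{u, v} \<in> E" for u v
    proof -
      consider "u = x" | "v = x" | "{u, v} \<in> ?F" "u \<noteq> x" "v \<noteq> x" using e by auto
      then show ?thesis
      proof cases
        case 1
        then show ?thesis using less[of v] out_x e by auto
      next
        case 2
        then show ?thesis using less[of u] out_x e by (auto simp: insert_commute)
      next
        case 3
        then show ?thesis using dist[OF 3(1)] D1(3)[of u] D1(3)[of v] by simp
      qed
    qed
    moreover have "h x' + outdeg D1 x' \<le> m" if "x' \<in> X" for x'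
      using DX[of x'] D1(3)[of x'] out_x that by (cases "x' = x") auto
    ultimately show ?thesis using D1(1) by blast
  next
    case last
    define B where "B = {y \<in> Y. pot y = m}"
    let ?F = "{e \<in> E. e \<inter> B = {}}"
    have F: "finite_simple_graph (V - B) ?F"
      using G by (auto simp: finite_simple_graph_def)
    obtain D where D: "orientation ?F D"
      and dist: "\<And>u v. {u, v} \<in> ?F \<Longrightarrow> h u + outdeg D u \<noteq> h v + outdeg D v"
      using weighted_proper_orientation_exists[OF F] by blast
    define D1 where "D1 = D \<union> (SIGMA b:B. nbrs E b)"
    have ind: "\<forall>e\<in>E. \<not> e \<subseteq> B" using indepY[of _ B] by (auto simp: B_def)
    note D1 = orient_away_from_independent[OF G ind D, folded D1_def]
    have out_B: "h y + outdeg D1 y = m" if "y \<in> B" for y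
      using D1(2)[OF that] that by (simp add: pot_def B_def)
    have less: "h x + outdeg D1 x < m" if x: "x \<in> X" for x
    proof -
      have "x \<notin> B" using x VXY by (auto simp: B_def)
      then have o: "outdeg D1 x \<le> card (nbrs ?F x)"
        using D1(3)[of x] outdeg_le_card_nbrs[OF F D, of x] by simp
      show ?thesis
      proof (cases "pot x < m")
        case True
        have "card (nbrs ?F x) \<le> card (nbrs E x)" by (rule card_nbrs_mono[OF G]) auto
        then show ?thesis using o True by (simp add: pot_def)
      next
        case False
        then have "h x < m" "\<forall>y. {x, y} \<in> E \<longrightarrow> pot y = m" using last[OF x] by auto
        moreover from this(2) have "nbrs ?F x = {}" using XY x by (auto simp: B_def)
        then have "card (nbrs ?F x) = 0" by (simp only: card.empty)
        ultimately show ?thesis using o by linarith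
      qed
    qed
    have "h u + outdeg D1 u \<noteq> h v + outdeg D1 v" if e: "{u, v} \<in> E" for u v
    proof -
      have XV: "v \<in> X" if "u \<in> B" using bip[OF e] that VXY by (auto simp: B_def doubleton_eq_iff)
      have XU: "u \<in> X" if "v \<in> B" using bip[OF e] that VXY by (auto simp: B_def doubleton_eq_iff)
      consider "u \<in> B" | "v \<in> B" | "{u, v} \<in> ?F" "u \<notin> B" "v \<notin> B" using e by auto
      then show ?thesis
      proof cases
        case 1
        then show ?thesis using less[OF XV] out_B by force
      next
        case 2
        then show ?thesis using less[OF XU] out_B by force
      next
        case 3
        then show ?thesis using dist[OF 3(1)] D1(3) by simp
      qed
    qed
    moreover have "\<forall>x\<in>X. h x + outdeg D1 x \<le> m" using less by (auto intro: less_imp_le)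
    ultimately show ?thesis using D1(1) by blast
  qed
qed

section \<open>From bounded outdegrees to proper orientations of bipartite graphs\<close>

lemma outdeg_flip_into:
  assumes G: "finite_simple_graph V E" and D: "orientation E D"
    and N: "N \<subseteq> {w. (w, v) \<in> D}"
  defines "D' \<equiv> (D - N \<times> {v}) \<union> {v} \<times> N"
  shows "orientation E D'"
    and "outdeg D' v = outdeg D v + card N"
    and "\<And>w. w \<noteq> v \<Longrightarrow> outdeg D' w \<le> outdeg D w"
    and "\<And>w. w \<noteq> v \<Longrightarrow> w \<notin> N \<Longrightarrow> outdeg D' w = outdeg D w"
proof -
  have D1: "{a, b} \<in> E" if "(a, b) \<in> D" for a b
    using D that unfolding orientation_def by blast
  have D2: "((a, b) \<in> D) \<noteq> ((b, a) \<in> D)" if "{a, b} \<in> E" for a b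
    using D that unfolding orientation_def by blast
  have vN: "v \<notin> N"
    using N D1[of v v] finite_simple_graph_edgeD[OF G, of v v] by blast
  have memb: "(a, b) \<in> D' \<longleftrightarrow> (a, b) \<in> D \<and> \<not> (a \<in> N \<and> b = v) \<or> a = v \<and> b \<in> N" for a b
    by (auto simp: D'_def)
  show "orientation E D'"
    unfolding orientation_def
  proof (intro conjI allI impI)
    show "{a, b} \<in> E" if "(a, b) \<in> D'" for a b
      using that D1[of a b] D1[of b a] N unfolding memb by (auto simp: insert_commute)
    fix a b assume e: "{a, b} \<in> E"
    have "a \<in> N \<Longrightarrow> (a, v) \<in> D" "b \<in> N \<Longrightarrow> (b, v) \<in> D" using N by auto
    then show "((a, b) \<in> D') \<noteq> ((b, a) \<in> D')"
      using D2[OF e] vN unfolding memb by metis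
  qed
  have fin: "finite {w. (v, w) \<in> D}" by (rule orientation_finite(3)[OF G D])
  have "N \<subseteq> V" using N orientation_finite(1)[OF G D] by auto
  then have finN: "finite N" using G finite_subset by (auto simp: finite_simple_graph_def)
  have "{w. (v, w) \<in> D'} = {w. (v, w) \<in> D} \<union> N" using vN unfolding memb by auto
  moreover have "{w. (v, w) \<in> D} \<inter> N = {}" using N orientation_asym[OF D] by blast
  ultimately show "outdeg D' v = outdeg D v + card N"
    using fin finN by (simp add: outdeg_def card_Un_disjoint)
  show "outdeg D' w \<le> outdeg D w" if "w \<noteq> v" for w
    unfolding outdeg_def using that orientation_finite(3)[OF G D, of w]
    by (intro card_mono) (auto simp: memb)
  show "outdeg D' w = outdeg D w" if "w \<noteq> v" "w \<notin> N" for w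
    unfolding outdeg_def memb using that by simp
qed

text \<open>
  Raise low vertices to their target, one after the other, as long as possible: a low vertex \<open>v\<close> with
  enough in-edges from other low vertices flips exactly as many of them as it needs. The vertices
  that lose an out-edge are low and stay low, and raised vertices are never touched again. When this
  stops, a low vertex stays strictly below its target even if it takes all its edges to low vertices.
\<close>

lemma saturated_orientation_exists:
  fixes t :: "'a \<Rightarrow> nat" and k :: nat
  assumes G: "finite_simple_graph V E"
    and D0: "orientation E D0" "\<forall>v\<in>V. outdeg D0 v \<le> k"
    and t: "\<forall>v\<in>V. k < t v"
  shows "\<exists>D H. orientation E D \<and> H \<subseteq> V \<and> (\<forall>v\<in>H. outdeg D v = t v) \<and>
    (\<forall>v\<in>V - H. outdeg D v \<le> k \<and>
      card {w \<in> H. (v, w) \<in> D} + card {w \<in> V - H. {v, w} \<in> E} < t v)"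
proof -
  define ok where "ok D H \<longleftrightarrow> orientation E D \<and> H \<subseteq> V \<and> (\<forall>v\<in>H. outdeg D v = t v) \<and>
    (\<forall>v\<in>V - H. outdeg D v \<le> k)" for D H
  have finV: "finite V" using G by (simp add: finite_simple_graph_def)
  \<comment> \<open>A maximal set of raised vertices replaces running the process to its end.\<close>
  define Hs where "Hs = {H. \<exists>D. ok D H}"
  have "Hs \<subseteq> Pow V" by (auto simp: Hs_def ok_def)
  then have "finite Hs" using finV finite_subset by blast
  moreover have "{} \<in> Hs" using D0 by (auto simp: Hs_def ok_def)
  ultimately obtain H where H: "H \<in> Hs" and max: "\<And>H'. H' \<in> Hs \<Longrightarrow> H \<subseteq> H' \<Longrightarrow> H' = H"
    using finite_has_maximal[of Hs] by (metis empty_iff)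
  then obtain D where ok: "ok D H" by (auto simp: Hs_def)
  then have D: "orientation E D" and HV: "H \<subseteq> V" and high: "\<And>v. v \<in> H \<Longrightarrow> outdeg D v = t v"
    and low: "\<And>v. v \<in> V - H \<Longrightarrow> outdeg D v \<le> k"
    by (auto simp: ok_def)
  have "card {w \<in> H. (v, w) \<in> D} + card {w \<in> V - H. {v, w} \<in> E} < t v" if v: "v \<in> V - H" for v
  proof (rule ccontr)
    assume ge: "\<not> ?thesis"
    let ?I = "{w \<in> V - H. (w, v) \<in> D}" and ?O = "{w \<in> V - H. (v, w) \<in> D}"
    have D1: "{a, b} \<in> E" if "(a, b) \<in> D" for a b
      using D that unfolding orientation_def by blast
    have D2: "((a, b) \<in> D) \<noteq> ((b, a) \<in> D)" if "{a, b} \<in> E" for a b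
      using D that unfolding orientation_def by blast
    have "{w \<in> V - H. {v, w} \<in> E} \<subseteq> ?I \<union> ?O"
      using D2[of v] by auto
    then have "card {w \<in> V - H. {v, w} \<in> E} \<le> card (?I \<union> ?O)"
      using finV by (intro card_mono) auto
    also have "\<dots> \<le> card ?I + card ?O" by (rule card_Un_le)
    finally have 1: "card {w \<in> V - H. {v, w} \<in> E} \<le> card ?I + card ?O" .
    have "{w. (v, w) \<in> D} = {w \<in> H. (v, w) \<in> D} \<union> ?O"
      using orientation_finite(1)[OF G D] HV by auto
    then have "outdeg D v = card ({w \<in> H. (v, w) \<in> D} \<union> ?O)"
      unfolding outdeg_def by (rule arg_cong)
    also have "\<dots> = card {w \<in> H. (v, w) \<in> D} + card ?O"
      using finV finite_subset[OF HV] by (intro card_Un_disjoint) auto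
    finally have "t v \<le> outdeg D v + card ?I" using ge 1 by simp
    then have "t v - outdeg D v \<le> card ?I" by simp
    from obtain_subset_with_card_n[OF this]
    obtain N where N: "N \<subseteq> ?I" "card N = t v - outdeg D v" .
    have Nin: "N \<subseteq> {w. (w, v) \<in> D}" using N by auto
    let ?D = "(D - N \<times> {v}) \<union> {v} \<times> N"
    note flip = outdeg_flip_into[OF G D Nin]
    have "ok ?D (insert v H)"
      unfolding ok_def
    proof (intro conjI ballI)
      show "orientation E ?D" by (rule flip(1))
      show "insert v H \<subseteq> V" using HV v by auto
      show "outdeg ?D w = t w" if "w \<in> insert v H" for w
      proof (cases "w = v")
        case True
        have "outdeg D v \<le> t v" using low[OF v] t v by force
        then show ?thesis using flip(2) N(2) True by simp
      next
        case False
        then have "w \<in> H" "w \<notin> N" using that N by auto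
        then show ?thesis using flip(4)[OF False] high by simp
      qed
      show "outdeg ?D w \<le> k" if "w \<in> V - insert v H" for w
        using flip(3)[of w] low[of w] that by auto
    qed
    then have "insert v H \<in> Hs" by (auto simp: Hs_def)
    then show False using max[of "insert v H"] v by auto
  qed
  with D HV high low show ?thesis by blast
qed

lemma replace_induced_orientation:
  assumes G: "finite_simple_graph V E" and D: "orientation E D"
    and DL: "orientation {e \<in> E. e \<subseteq> L} DL"
  defines "D' \<equiv> (D - L \<times> L) \<union> DL"
  shows "orientation E D'"
    and "\<And>v. v \<notin> L \<Longrightarrow> outdeg D' v = outdeg D v"
    and "\<And>v. v \<in> L \<Longrightarrow> outdeg D' v = card {w. w \<notin> L \<and> (v, w) \<in> D} + outdeg DL v"
proof -
  have D1: "{a, b} \<in> E" if "(a, b) \<in> D" for a b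
    using D that unfolding orientation_def by blast
  have D2: "((a, b) \<in> D) \<noteq> ((b, a) \<in> D)" if "{a, b} \<in> E" for a b
    using D that unfolding orientation_def by blast
  have L1: "{a, b} \<in> E" "a \<in> L" "b \<in> L" if "(a, b) \<in> DL" for a b
  proof -
    have "{a, b} \<in> {e \<in> E. e \<subseteq> L}" using DL that unfolding orientation_def by blast
    then show "{a, b} \<in> E" "a \<in> L" "b \<in> L" by simp_all
  qed
  have L2: "((a, b) \<in> DL) \<noteq> ((b, a) \<in> DL)" if "{a, b} \<in> E" "a \<in> L" "b \<in> L" for a b
  proof -
    have "{a, b} \<in> {e \<in> E. e \<subseteq> L}" using that by simp
    then show ?thesis using DL unfolding orientation_def by blast
  qed
  have memb: "(a, b) \<in> D' \<longleftrightarrow> (if a \<in> L \<and> b \<in> L then (a, b) \<in> DL else (a, b) \<in> D)" for a b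
    using L1 by (auto simp: D'_def)
  show "orientation E D'"
    unfolding orientation_def
  proof (intro conjI allI impI)
    show "{a, b} \<in> E" if "(a, b) \<in> D'" for a b
      using that D1 L1(1) unfolding memb by metis
    fix a b assume e: "{a, b} \<in> E"
    show "((a, b) \<in> D') \<noteq> ((b, a) \<in> D')"
      using D2[OF e] L2[OF e] unfolding memb by metis
  qed
  show "outdeg D' v = outdeg D v" if "v \<notin> L" for v
    unfolding outdeg_def memb using that by simp
  show "outdeg D' v = card {w. w \<notin> L \<and> (v, w) \<in> D} + outdeg DL v" if "v \<in> L" for v
  proof -
    have "{w. (v, w) \<in> D'} = {w. w \<notin> L \<and> (v, w) \<in> D} \<union> {w. (v, w) \<in> DL}"
      using that L1(3) unfolding memb by auto
    moreover have "finite {w. w \<notin> L \<and> (v, w) \<in> D}"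
      using orientation_finite(3)[OF G D, of v] by (rule rev_finite_subset) auto
    moreover have "finite {w. (v, w) \<in> DL}"
      using nbrs_finite(2)[OF G, of v] by (rule rev_finite_subset) (use L1(1) in auto)
    moreover have "{w. w \<notin> L \<and> (v, w) \<in> D} \<inter> {w. (v, w) \<in> DL} = {}" using L1(3) by auto
    ultimately show ?thesis by (simp add: outdeg_def card_Un_disjoint)
  qed
qed

text \<open>
  Saturate with target \<open>k + 3\<close> on \<open>X\<close> and \<open>k + 2\<close> on \<open>Y\<close>. Two raised neighbours then differ, and
  whatever happens to the edges between low vertices, a low \<open>y\<close> is at most \<open>k + 1\<close> and a low \<open>x\<close> at most
  \<open>k + 2\<close>. The only danger is a low \<open>x\<close> of value \<open>k + 2\<close> next to a raised \<open>y\<close>. The capped lemma for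
  \<open>m = k + 1\<close> reorients the low part so that this does not happen; a low vertex has at most \<open>k\<close>
  out-edges to raised vertices, which is the condition \<open>h x < m\<close> on critical vertices.
\<close>

lemma bipartite_proper_orientation_le:
  fixes k :: nat
  assumes G: "finite_simple_graph V E" and "bipartite_graph V E"
    and D0: "orientation E D0" "\<forall>v\<in>V. outdeg D0 v \<le> k"
  shows "\<exists>D. proper_orientation E D \<and> (\<forall>v\<in>V. outdeg D v \<le> k + 3)"
proof -
  from assms(2) obtain X Y where "X \<union> Y = V \<and> X \<inter> Y = {} \<and> (\<forall>e\<in>E. \<exists>x\<in>X. \<exists>y\<in>Y. e = {x, y})"
    unfolding bipartite_graph_def by (elim exE)
  then have XY: "X \<union> Y = V" "X \<inter> Y = {}"
    and bip: "\<And>e. e \<in> E \<Longrightarrow> \<exists>x\<in>X. \<exists>y\<in>Y. e = {x, y}"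
    by simp_all
  have finV: "finite V" using G by (simp add: finite_simple_graph_def)
  define t where "t v = (if v \<in> X then k + 3 else k + 2)" for v
  have "\<forall>v\<in>V. k < t v" by (simp add: t_def)
  from saturated_orientation_exists[OF G D0 this]
  obtain D H where "orientation E D \<and> H \<subseteq> V \<and> (\<forall>v\<in>H. outdeg D v = t v) \<and>
    (\<forall>v\<in>V - H. outdeg D v \<le> k \<and>
      card {w \<in> H. (v, w) \<in> D} + card {w \<in> V - H. {v, w} \<in> E} < t v)"
    by (elim exE)
  then have D: "orientation E D" and HV: "H \<subseteq> V"
    and high: "\<And>v. v \<in> H \<Longrightarrow> outdeg D v = t v"
    and low: "\<And>v. v \<in> V - H \<Longrightarrow> outdeg D v \<le> k"
    and sat: "\<And>v. v \<in> V - H \<Longrightarrow>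
      card {w \<in> H. (v, w) \<in> D} + card {w \<in> V - H. {v, w} \<in> E} < t v"
    by simp_all
  define L where "L = V - H"
  define h where "h v = card {w. w \<notin> L \<and> (v, w) \<in> D}" for v
  let ?E = "{e \<in> E. e \<subseteq> L}"
  have h: "h v = card {w \<in> H. (v, w) \<in> D}" for v
    unfolding h_def L_def using orientation_finite(1)[OF G D] HV
    by (intro arg_cong[where f = card]) auto
  have deg: "nbrs ?E v = {w \<in> V - H. {v, w} \<in> E}" if "v \<in> L" for v
    using that by (auto simp: L_def)
  have hk: "h v \<le> k" if "v \<in> L" for v
  proof -
    have "h v \<le> outdeg D v"
      unfolding h_def outdeg_def using orientation_finite(3)[OF G D, of v]
      by (intro card_mono) auto
    then show ?thesis using low that by (force simp: L_def)
  qed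
  have "\<exists>DL. orientation ?E DL \<and>
    (\<forall>u v. {u, v} \<in> ?E \<longrightarrow> h u + outdeg DL u \<noteq> h v + outdeg DL v) \<and>
    (\<forall>x\<in>X \<inter> L. h x + outdeg DL x \<le> k + 1)"
  proof (rule capped_proper_orientation_exists[where Y = "Y \<inter> L"])
    show "finite_simple_graph L ?E"
      using G by (auto simp: finite_simple_graph_def L_def)
    show "L = X \<inter> L \<union> Y \<inter> L" "(X \<inter> L) \<inter> (Y \<inter> L) = {}"
      using XY by (auto simp: L_def)
    show "\<exists>x\<in>X \<inter> L. \<exists>y\<in>Y \<inter> L. e = {x, y}" if "e \<in> ?E" for e
      using that bip[of e] by auto
    show "h y + card (nbrs ?E y) \<le> k + 1" if "y \<in> Y \<inter> L" for y
    proof -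
      have "y \<notin> X" using that XY by auto
      then show ?thesis using sat[of y] that deg[of y] by (simp add: L_def h t_def)
    qed
    show "h x + card (nbrs ?E x) \<le> k + 1 \<or> h x + card (nbrs ?E x) = k + 1 + 1 \<and> h x < k + 1"
      if "x \<in> X \<inter> L" for x
    proof -
      have "h x + card (nbrs ?E x) < k + 3"
        using sat[of x] that deg[of x] by (simp add: L_def h t_def)
      then show ?thesis using hk[of x] that by auto
    qed
  qed
  then obtain DL where DL: "orientation ?E DL"
    and dist: "\<And>u v. {u, v} \<in> ?E \<Longrightarrow> h u + outdeg DL u \<noteq> h v + outdeg DL v"
    and capX: "\<And>x. x \<in> X \<inter> L \<Longrightarrow> h x + outdeg DL x \<le> k + 1"
    by blast
  define D' where "D' = (D - L \<times> L) \<union> DL"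
  note D' = replace_induced_orientation[OF G D DL, folded D'_def h_def]
  have outH: "outdeg D' v = t v" if "v \<in> H" for v
    using D'(2)[of v] high that by (simp add: L_def)
  have capY: "outdeg D' y \<le> k + 1" if "y \<in> Y" "y \<in> L" for y
  proof -
    have "outdeg DL y \<le> card (nbrs ?E y)"
      using DL G by (intro outdeg_le_card_nbrs[of V]) (auto simp: finite_simple_graph_def)
    moreover have "y \<notin> X" using that XY by auto
    ultimately show ?thesis
      using D'(3)[of y] sat[of y] that deg[of y] by (simp add: L_def h t_def)
  qed
  have capX: "outdeg D' x \<le> k + 1" if "x \<in> X" "x \<in> L" for x
    using D'(3)[of x] capX[of x] that by simp
  have neq: "outdeg D' x \<noteq> outdeg D' y" if "{x, y} \<in> E" "x \<in> X" "y \<in> Y" for x y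
  proof -
    have yX: "y \<notin> X" using that XY by auto
    have V: "x \<in> H \<or> x \<in> L" "y \<in> H \<or> y \<in> L" using that XY by (auto simp: L_def)
    show ?thesis
    proof (cases "x \<in> L \<and> y \<in> L")
      case True
      then have "{x, y} \<in> ?E" using that by auto
      from dist[OF this] show ?thesis using D'(3) True by simp
    next
      case False
      then show ?thesis
        using V outH[of x] outH[of y] capX[of x] capY[of y] that yX by (auto simp: t_def)
    qed
  qed
  have "proper_orientation E D'"
    unfolding proper_orientation_def
  proof (intro conjI allI impI)
    show "orientation E D'" by (rule D'(1))
    fix u v assume e: "{u, v} \<in> E"
    then obtain x y where "x \<in> X" "y \<in> Y" "{u, v} = {x, y}" using bip by blast
    then show "outdeg D' u \<noteq> outdeg D' v"
      using neq[of x y] e by (metis doubleton_eq_iff)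
  qed
  moreover have "outdeg D' v \<le> k + 3" if "v \<in> V" for v
    using that XY outH[of v] capX[of v] capY[of v] by (fastforce simp: L_def t_def)
  ultimately show ?thesis by blast
qed

section \<open>Adding an arc to a compact subset of the plane\<close>

lemma connected_component_mono_compl:
  assumes "connected_component (- T) a b" "S \<subseteq> T"
  shows "connected_component (- S) a b"
  using assms by (meson Compl_subset_Compl_iff connected_component_of_subset)

lemma arc_interior_connected_nonempty:
  assumes "arc c"
  shows "connected (arc_interior c)" "arc_interior c \<noteq> {}"
  using assms connected_simple_path_endless nonempty_simple_path_endless arc_imp_simple_path
  unfolding arc_interior_def by blast+

text \<open>
  An arc joining two disjoint compact sets separates nothing new. By Janiszewski's theorem the union
  of two compact sets with connected intersection does not separate points that neither set
  separates; it is used once to attach the arc to \<open>K2\<close> and once to attach the result to \<open>K1\<close>, both times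
  with a single point as intersection.
\<close>

lemma bridge_keeps_complement_connected:
  fixes c :: "real \<Rightarrow> complex"
  assumes "arc c" "compact K1" "compact K2" "K1 \<inter> K2 = {}"
    and c1: "path_image c \<inter> K1 = {pathstart c}" and c2: "path_image c \<inter> K2 = {pathfinish c}"
    and ab: "connected_component (- (K1 \<union> K2)) a b" "a \<notin> path_image c" "b \<notin> path_image c"
  shows "connected_component (- (K1 \<union> K2 \<union> path_image c)) a b"
proof -
  have c: "compact (path_image c)" using assms(1) by (simp add: arc_imp_path compact_path_image)
  have "connected (- path_image c)"
    using assms(1) by (intro connected_arc_complement) auto
  then have cc: "connected_component (- path_image c) a b"
    using ab by (meson ComplI connected_iff_connected_component)
  have "connected_component (- (K2 \<union> path_image c)) a b"
  proof (rule Janiszewski)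
    show "connected_component (- K2) a b"
      using connected_component_mono_compl[OF ab(1)] by blast
    show "connected (K2 \<inter> path_image c)" using c2 by (simp add: Int_commute)
  qed (use assms c cc compact_imp_closed in auto)
  moreover have "connected_component (- K1) a b"
    using connected_component_mono_compl[OF ab(1)] by blast
  moreover have "K1 \<inter> (K2 \<union> path_image c) = {pathstart c}" using assms by blast
  moreover have "closed (K2 \<union> path_image c)" using assms c by (simp add: compact_imp_closed closed_Un)
  ultimately have "connected_component (- (K1 \<union> (K2 \<union> path_image c))) a b"
    using Janiszewski[OF assms(2), of "K2 \<union> path_image c" a b] by simp
  then show ?thesis by (simp add: Un_assoc)
qed

text \<open>
  If the ends of \<open>c\<close> are joined inside \<open>S\<close>, then \<open>c\<close> lies on a Jordan curve whose remaining part runs in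
  \<open>S\<close>. That this part, being all of the intersection with \<open>S\<close>, is connected makes Janiszewski's
  theorem applicable to \<open>S\<close> and the curve.
\<close>

lemma arc_closes_to_simple_closed_curve:
  fixes c :: "real \<Rightarrow> complex"
  assumes "arc c" "path_image c \<inter> S = {pathstart c, pathfinish c}"
    and "path_component S (pathstart c) (pathfinish c)"
  obtains z where "simple_path z" "pathfinish z = pathstart z" "path_image c \<subseteq> path_image z"
    "path_image z \<subseteq> S \<union> path_image c" "connected (S \<inter> path_image z)"
proof -
  let ?P = "path_component_set S (pathfinish c)"
  have "path_connected ?P" by (rule path_connected_path_component)
  moreover have "pathfinish c \<in> S" using assms(2) by blast
  then have "pathfinish c \<in> ?P" by (simp add: path_component_refl)
  moreover have "pathstart c \<in> ?P" using assms(3) by (simp add: path_component_sym)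
  moreover have "pathfinish c \<noteq> pathstart c" using assms(1) by (rule arc_distinct_ends)
  ultimately obtain g where g: "arc g" "path_image g \<subseteq> ?P" "pathstart g = pathfinish c"
    "pathfinish g = pathstart c"
    unfolding path_connected_arcwise by blast
  have gS: "path_image g \<subseteq> S" using g(2) path_component_subset by blast
  have zi: "path_image (c +++ g) = path_image c \<union> path_image g"
    using g by (simp add: path_image_join)
  have int: "path_image c \<inter> path_image g \<subseteq> {pathstart c, pathstart g}"
    using assms(2) gS g(3) by auto
  show thesis
  proof
    show "simple_path (c +++ g)"
      using simple_path_join_loop[OF assms(1) g(1) _ _ int] g by simp
    show "pathfinish (c +++ g) = pathstart (c +++ g)" using g by simp
    have "pathstart c \<in> path_image g" "pathfinish c \<in> path_image g"
      using g by (metis pathfinish_in_path_image, metis pathstart_in_path_image)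
    then have "path_image c \<inter> S \<subseteq> path_image g"
      unfolding assms(2) by simp
    then have "S \<inter> path_image (c +++ g) = path_image g"
      using gS unfolding zi by blast
    then show "connected (S \<inter> path_image (c +++ g))"
      using g(1) by (simp add: arc_imp_path connected_path_image)
  qed (use zi gS in auto)
qed

lemma connected_component_if_same_side:
  fixes S :: "complex set"
  assumes "compact S" "simple_path z" "pathfinish z = pathstart z" "connected (S \<inter> path_image z)"
    and "connected_component (- S) a b"
    and "a \<in> inside (path_image z) \<and> b \<in> inside (path_image z) \<or>
      a \<in> outside (path_image z) \<and> b \<in> outside (path_image z)"
  shows "connected_component (- (S \<union> path_image z)) a b"
proof (rule Janiszewski)
  note J = Jordan_inside_outside[OF assms(2,3)]
  show "closed (path_image z)"
    using assms(2) by (simp add: simple_path_imp_path compact_path_image compact_imp_closed)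
  have "inside (path_image z) \<subseteq> - path_image z" "outside (path_image z) \<subseteq> - path_image z"
    using J by blast+
  then show "connected_component (- path_image z) a b"
    using J assms(6) unfolding connected_component_def by blast
qed (use assms in auto)

text \<open>
  The new arc cuts a face of \<open>S\<close> into at most two faces: of three points, two lie on the same side of
  the Jordan curve through \<open>c\<close>, and neither \<open>S\<close> nor the curve separates these two.
\<close>

lemma arc_touches_at_most_two_faces:
  fixes c :: "real \<Rightarrow> complex"
  assumes "arc c" "compact S" "path_image c \<inter> S = {pathstart c, pathfinish c}"
    and "path_component S (pathstart c) (pathfinish c)"
    and abc: "a1 \<notin> path_image c" "a2 \<notin> path_image c" "a3 \<notin> path_image c"
    and S: "connected_component (- S) a1 a2" "connected_component (- S) a1 a3"
  shows "connected_component (- (S \<union> path_image c)) a1 a2 \<or>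
    connected_component (- (S \<union> path_image c)) a1 a3 \<or>
    connected_component (- (S \<union> path_image c)) a2 a3"
proof -
  obtain z where z: "simple_path z" "pathfinish z = pathstart z" "path_image c \<subseteq> path_image z"
    "path_image z \<subseteq> S \<union> path_image c" "connected (S \<inter> path_image z)"
    using arc_closes_to_simple_closed_curve[OF assms(1,3,4)] .
  have eq: "S \<union> path_image z = S \<union> path_image c" using z by blast
  note same = connected_component_if_same_side[OF assms(2) z(1,2,5), unfolded eq]
  have S3: "connected_component (- S) a2 a3"
    using S connected_component_sym connected_component_trans by metis
  have "a1 \<notin> S" "a2 \<notin> S" "a3 \<notin> S"
    using S connected_component_in by (metis ComplD)+
  then have "a1 \<in> - path_image z" "a2 \<in> - path_image z" "a3 \<in> - path_image z"
    using abc z by blast+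
  moreover have "inside (path_image z) \<union> outside (path_image z) = - path_image z"
    using Jordan_inside_outside[OF z(1,2)] by blast
  ultimately have "a \<in> inside (path_image z) \<or> a \<in> outside (path_image z)" if "a \<in> {a1, a2, a3}" for a
    using that by blast
  then show ?thesis using same[OF S(1)] same[OF S(2)] same[OF S3] by auto
qed

lemma connected_compl_finite:
  fixes F :: "complex set"
  assumes "finite F"
  shows "connected (- F)"
  using connected_open_delete_finite[of "UNIV :: complex set" F] assms connected_UNIV
  by (simp add: Compl_eq_Diff_UNIV)

text \<open>
  Otherwise the interior of the arc and the complement of the arc would disconnect the plane without
  the two ends of the arc.
\<close>

lemma arc_interior_not_open:
  fixes c :: "real \<Rightarrow> complex"
  assumes "arc c"
  shows "\<not> open (arc_interior c)"
proof
  assume op: "open (arc_interior c)"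
  let ?F = "{pathstart c, pathfinish c}"
  have c: "compact (path_image c)" using assms(1) by (simp add: arc_imp_path compact_path_image)
  have "connected (- ?F)" by (rule connected_compl_finite) simp
  moreover have "open (- path_image c)" using c by (simp add: compact_imp_closed open_Compl)
  moreover have "- ?F \<subseteq> arc_interior c \<union> - path_image c"
    by (auto simp: arc_interior_def)
  moreover have "arc_interior c \<inter> - path_image c \<inter> - ?F = {}"
    by (auto simp: arc_interior_def)
  moreover have "arc_interior c \<inter> - ?F \<noteq> {}"
    using arc_interior_connected_nonempty(2)[OF assms] by (auto simp: arc_interior_def)
  moreover have "- path_image c \<inter> - ?F \<noteq> {}"
  proof -
    have "path_image c \<noteq> UNIV"
      using c compact_imp_bounded not_bounded_UNIV by metis
    then show ?thesis by auto
  qed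
  ultimately show False
    using op connectedD[of "- ?F" "arc_interior c" "- path_image c"] by blast
qed

text \<open>
  Points of both sides of the Jordan curve through \<open>c\<close> occur arbitrarily close to an interior point of
  \<open>c\<close>, hence within one face of \<open>S\<close>; the new arc completes the curve, which separates them.
\<close>

lemma arc_splits_face:
  fixes c :: "real \<Rightarrow> complex"
  assumes "arc c" "compact S" "path_image c \<inter> S = {pathstart c, pathfinish c}"
    and "path_component S (pathstart c) (pathfinish c)"
  obtains a b where "a \<notin> S \<union> path_image c" "b \<notin> S \<union> path_image c"
    "connected_component (- S) a b" "\<not> connected_component (- (S \<union> path_image c)) a b"
proof -
  obtain z where z: "simple_path z" "pathfinish z = pathstart z" "path_image c \<subseteq> path_image z"
    "path_image z \<subseteq> S \<union> path_image c" "connected (S \<inter> path_image z)"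
    using arc_closes_to_simple_closed_curve[OF assms(1,3,4)] .
  let ?I = "inside (path_image z)" and ?O = "outside (path_image z)"
  have J: "open ?I" "open ?O" "?I \<inter> ?O = {}" "?I \<union> ?O = - path_image z"
    "frontier ?I = path_image z" "frontier ?O = path_image z"
    using Jordan_inside_outside[OF z(1,2)] by blast+
  obtain x where x: "x \<in> arc_interior c"
    using arc_interior_connected_nonempty(2)[OF assms(1)] by blast
  then have xc: "x \<in> path_image c" "x \<notin> S"
    using assms(3) by (auto simp: arc_interior_def)
  have "open (- S)" using assms(2) by (simp add: compact_imp_closed open_Compl)
  then obtain d where d: "d > 0" "ball x d \<subseteq> - S"
    using xc by (meson ComplI openE)
  have "x \<in> closure ?I" "x \<in> closure ?O"
    using xc z(3) J(5,6) by (auto simp: frontier_def)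
  then obtain a b where a: "a \<in> ?I" "a \<in> ball x d" and b: "b \<in> ?O" "b \<in> ball x d"
    using d(1) by (metis closure_approachable dist_commute mem_ball)
  show thesis
  proof
    have "a \<notin> path_image z" "b \<notin> path_image z" using a(1) b(1) J(4) by blast+
    then show "a \<notin> S \<union> path_image c" "b \<notin> S \<union> path_image c"
      using a(2) b(2) d(2) z(3) by blast+
    show "connected_component (- S) a b"
      unfolding connected_component_def using a(2) b(2) d(2) connected_ball by blast
    show "\<not> connected_component (- (S \<union> path_image c)) a b"
    proof
      assume "connected_component (- (S \<union> path_image c)) a b"
      then obtain T where T: "connected T" "T \<subseteq> - (S \<union> path_image c)" "a \<in> T" "b \<in> T"
        unfolding connected_component_def by blast
      have "T \<subseteq> ?I \<union> ?O" using T(2) z(4) J(4) by blast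
      moreover have "?I \<inter> T \<noteq> {}" "?O \<inter> T \<noteq> {}" using T(3,4) a(1) b(1) by blast+
      moreover have "?I \<inter> ?O \<inter> T = {}" using J(3) by blast
      ultimately show False using connectedD[OF T(1) J(1,2)] by blast
    qed
  qed
qed

text \<open>
  No face of \<open>S\<close> is swallowed by the arc, since it would then coincide with the open interior of the arc.
\<close>

lemma face_point_off_arc:
  fixes c :: "real \<Rightarrow> complex"
  assumes "arc c" "closed S" "path_image c \<inter> S = {pathstart c, pathfinish c}" "a \<notin> S"
  obtains b where "b \<notin> S \<union> path_image c" "connected_component (- S) a b"
proof -
  let ?C = "connected_component_set (- S) a"
  have "open ?C" using assms(2) by (simp add: open_Compl open_connected_component)
  have CS: "?C \<subseteq> - S" by (rule connected_component_subset)
  have "\<not> ?C \<subseteq> path_image c"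
  proof
    assume "?C \<subseteq> path_image c"
    then have sub: "?C \<subseteq> arc_interior c" using CS assms(3) by (auto simp: arc_interior_def)
    have "arc_interior c \<subseteq> - S" using assms(3) by (auto simp: arc_interior_def)
    moreover have "a \<in> arc_interior c" using sub assms(4) connected_component_refl by fastforce
    ultimately have "arc_interior c \<subseteq> ?C"
      using arc_interior_connected_nonempty(1)[OF assms(1)] connected_component_maximal by blast
    then have "?C = arc_interior c" using sub by blast
    then show False using \<open>open ?C\<close> arc_interior_not_open[OF assms(1)] by simp
  qed
  then show thesis using that CS by blast
qed


section \<open>Plane drawings and their faces\<close>

locale plane_graph =
  fixes V :: "'a set" and E :: "'a set set" and p :: "'a \<Rightarrow> complex"
    and \<gamma> :: "'a set \<Rightarrow> real \<Rightarrow> complex"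
  assumes graph: "finite_simple_graph V E" and drawing: "plane_drawing V E p \<gamma>"
begin

definition drawn :: "'a set set \<Rightarrow> complex set" where
  "drawn F = p ` V \<union> (\<Union>e\<in>F. path_image (\<gamma> e))"

lemma finite_V: "finite V" and finite_E: "finite E"
proof -
  show "finite V" using graph by (simp add: finite_simple_graph_def)
  moreover have "E \<subseteq> Pow V" using graph by (auto simp: finite_simple_graph_def)
  ultimately show "finite E" by (meson finite_Pow_iff finite_subset)
qed

lemma edge_arc: "e \<in> E \<Longrightarrow> arc (\<gamma> e)"
  using drawing by (simp add: plane_drawing_def)

lemma edge_ends:
  assumes "e \<in> E"
  obtains u v where "e = {u, v}" "u \<in> V" "v \<in> V" "u \<noteq> v"
    "pathstart (\<gamma> e) = p u" "pathfinish (\<gamma> e) = p v"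
proof -
  have sub: "e \<subseteq> V" "card e = 2" using graph assms by (auto simp: finite_simple_graph_def)
  have eq: "{pathstart (\<gamma> e), pathfinish (\<gamma> e)} = p ` e"
    using drawing assms by (simp add: plane_drawing_def)
  obtain x y where xy: "e = {x, y}" "x \<noteq> y" using sub(2) by (auto simp: card_2_iff)
  have "pathstart (\<gamma> e) = p x \<and> pathfinish (\<gamma> e) = p y \<or>
      pathstart (\<gamma> e) = p y \<and> pathfinish (\<gamma> e) = p x"
    using eq unfolding xy(1) by (auto simp: doubleton_eq_iff)
  then show thesis using that[of x y] that[of y x] xy sub by (auto simp: insert_commute)
qed

lemma vertex_on_edge:
  assumes "e \<in> E" "w \<in> V" "p w \<in> path_image (\<gamma> e)"
  shows "w \<in> e"
proof -
  have "arc_interior (\<gamma> e) \<inter> p ` V = {}" using drawing assms(1) by (simp add: plane_drawing_def)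
  then have "p w \<in> {pathstart (\<gamma> e), pathfinish (\<gamma> e)}"
    using assms(2,3) by (auto simp: arc_interior_def)
  moreover obtain u v where "e = {u, v}" "u \<in> V" "v \<in> V" "u \<noteq> v"
    "pathstart (\<gamma> e) = p u" "pathfinish (\<gamma> e) = p v"
    using edge_ends[OF assms(1)] .
  moreover have "inj_on p V" using drawing by (simp add: plane_drawing_def)
  ultimately show ?thesis using assms(2) by (auto simp: inj_on_def)
qed

lemma edges_meet_in_vertex:
  assumes "e \<in> E" "f \<in> E" "e \<noteq> f" "x \<in> path_image (\<gamma> e)" "x \<in> path_image (\<gamma> f)"
  shows "\<exists>w\<in>V. w \<in> e \<and> w \<in> f \<and> x = p w"
proof -
  have "arc_interior (\<gamma> e) \<inter> path_image (\<gamma> f) = {}"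
    using drawing assms(1-3) unfolding plane_drawing_def by blast
  then have x: "x \<in> {pathstart (\<gamma> e), pathfinish (\<gamma> e)}"
    using assms(4,5) by (auto simp: arc_interior_def)
  obtain u v where uv: "e = {u, v}" "u \<in> V" "v \<in> V" "u \<noteq> v"
    "pathstart (\<gamma> e) = p u" "pathfinish (\<gamma> e) = p v"
    using edge_ends[OF assms(1)] .
  then obtain w where w: "w \<in> e" "w \<in> V" "x = p w" using x by blast
  then have "w \<in> f" using vertex_on_edge[OF assms(2)] assms(5) by blast
  with w show ?thesis by blast
qed

lemma edge_inter_drawn:
  assumes "e \<in> E" "F \<subseteq> E" "e \<notin> F"
  shows "path_image (\<gamma> e) \<inter> drawn F = {pathstart (\<gamma> e), pathfinish (\<gamma> e)}"
proof
  obtain u v where uv: "e = {u, v}" "u \<in> V" "v \<in> V" "u \<noteq> v"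
    "pathstart (\<gamma> e) = p u" "pathfinish (\<gamma> e) = p v"
    using edge_ends[OF assms(1)] .
  show "{pathstart (\<gamma> e), pathfinish (\<gamma> e)} \<subseteq> path_image (\<gamma> e) \<inter> drawn F"
    using uv(2,3,5,6) pathstart_in_path_image[of "\<gamma> e"] pathfinish_in_path_image[of "\<gamma> e"]
    by (simp add: drawn_def)
  show "path_image (\<gamma> e) \<inter> drawn F \<subseteq> {pathstart (\<gamma> e), pathfinish (\<gamma> e)}"
  proof
    fix x assume x: "x \<in> path_image (\<gamma> e) \<inter> drawn F"
    then consider w where "w \<in> V" "x = p w" | f where "f \<in> F" "x \<in> path_image (\<gamma> f)"
      by (auto simp: drawn_def)
    then obtain w where "w \<in> e" "x = p w"
    proof cases
      case (1 w)
      then show thesis using that[of w] vertex_on_edge[OF assms(1)] x by auto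
    next
      case (2 f)
      then have "f \<in> E" "e \<noteq> f" using assms by auto
      from edges_meet_in_vertex[OF assms(1) this, of x] 2 x
      obtain w where "w \<in> e" "x = p w" by auto
      then show thesis by (rule that)
    qed
    then show "x \<in> {pathstart (\<gamma> e), pathfinish (\<gamma> e)}" using uv by auto
  qed
qed

lemma drawn_insert: "drawn (insert e F) = drawn F \<union> path_image (\<gamma> e)"
  by (auto simp: drawn_def)

lemma compact_edges:
  assumes "F \<subseteq> E" "finite W"
  shows "compact (p ` W \<union> (\<Union>e\<in>F. path_image (\<gamma> e)))"
proof (rule compact_Un)
  show "compact (p ` W)" using assms(2) by (simp add: finite_imp_compact)
  show "compact (\<Union>e\<in>F. path_image (\<gamma> e))"
  proof (rule compact_UN)
    show "finite F" using assms(1) finite_E finite_subset by blast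
    show "compact (path_image (\<gamma> e))" if "e \<in> F" for e
      using that assms(1) edge_arc arc_imp_path compact_path_image by blast
  qed
qed

lemma compact_drawn: "F \<subseteq> E \<Longrightarrow> compact (drawn F)"
  unfolding drawn_def using compact_edges finite_V by blast

text \<open>
  The set \<open>A\<close> exhibits \<open>e\<close> as a bridge of \<open>insert e F\<close>: the edges of \<open>F\<close> inside \<open>A\<close> and those outside \<open>A\<close> are
  drawn as two disjoint compact sets, which \<open>e\<close> joins.
\<close>

lemma cut_edge_keeps_faces:
  assumes "e \<in> E" "F \<subseteq> E" "e \<notin> F"
    and cut: "\<And>f. f \<in> F \<Longrightarrow> f \<subseteq> A \<or> f \<inter> A = {}"
    and e: "e = {s, t}" "s \<in> A" "t \<notin> A"
    and ab: "connected_component (- drawn F) a b" "a \<notin> path_image (\<gamma> e)" "b \<notin> path_image (\<gamma> e)"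
  shows "connected_component (- drawn (insert e F)) a b"
proof -
  define K where "K W = p ` (V \<inter> W) \<union> (\<Union>f\<in>{f \<in> F. f \<subseteq> W}. path_image (\<gamma> f))" for W
  have Ksub: "K W \<subseteq> drawn F" for W by (auto simp: K_def drawn_def)
  have KK: "K A \<union> K (- A) = drawn F"
  proof
    show "K A \<union> K (- A) \<subseteq> drawn F" using Ksub by blast
    show "drawn F \<subseteq> K A \<union> K (- A)"
    proof
      fix x assume "x \<in> drawn F"
      then consider w where "w \<in> V" "x = p w" | f where "f \<in> F" "x \<in> path_image (\<gamma> f)"
        by (auto simp: drawn_def)
      then show "x \<in> K A \<union> K (- A)"
      proof cases
        case (1 w)
        then show ?thesis by (cases "w \<in> A") (auto simp: K_def)
      next
        case (2 f)
        then have "f \<subseteq> A \<or> f \<subseteq> - A" using cut by blast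
        with 2 show ?thesis by (auto simp: K_def)
      qed
    qed
  qed
  have comp: "compact (K W)" for W
    unfolding K_def using assms(2) finite_V by (intro compact_edges) auto
  have mem: "w \<in> W" if "p w \<in> K W" "w \<in> V" for w W
  proof -
    have inj: "inj_on p V" using drawing by (simp add: plane_drawing_def)
    from that(1) consider w' where "w' \<in> V" "w' \<in> W" "p w = p w'"
      | f where "f \<in> F" "f \<subseteq> W" "p w \<in> path_image (\<gamma> f)"
      by (auto simp: K_def)
    then show ?thesis
    proof cases
      case 1
      then show ?thesis using inj that(2) by (auto simp: inj_on_def)
    next
      case (2 f)
      then show ?thesis using vertex_on_edge[of f w] that(2) assms(2) by blast
    qed
  qed
  have disj: "K A \<inter> K (- A) = {}"
  proof (rule ccontr)
    assume "K A \<inter> K (- A) \<noteq> {}"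
    then obtain x where x: "x \<in> K A" "x \<in> K (- A)" by blast
    have "x \<in> p ` V"
    proof (rule ccontr)
      assume n: "x \<notin> p ` V"
      then obtain f g where f: "f \<in> F" "f \<subseteq> A" "x \<in> path_image (\<gamma> f)"
        and g: "g \<in> F" "g \<subseteq> - A" "x \<in> path_image (\<gamma> g)"
        using x by (auto simp: K_def)
      have "f \<noteq> {}" using edge_ends[of f] f assms(2) by blast
      then have "f \<noteq> g" using f g by blast
      then show False using edges_meet_in_vertex[of f g x] f g assms(2) n by blast
    qed
    then obtain w where "w \<in> V" "x = p w" by blast
    then show False using mem x by blast
  qed
  have arc: "arc (\<gamma> e)" using edge_arc assms(1) by blast
  have stV: "s \<in> V" "t \<in> V"
    using graph assms(1) e(1) by (auto simp: finite_simple_graph_def)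
  have pK: "p s \<in> K A" "p t \<in> K (- A)" using e stV by (auto simp: K_def)
  then have npK: "p t \<notin> K A" "p s \<notin> K (- A)" using disj by blast+
  have ends: "path_image (\<gamma> e) \<inter> drawn F = {p s, p t}"
  proof -
    obtain u v where uv: "e = {u, v}" "pathstart (\<gamma> e) = p u" "pathfinish (\<gamma> e) = p v"
      using edge_ends[OF assms(1)] .
    then have "{p u, p v} = p ` {s, t}" using e(1) by auto
    then show ?thesis using edge_inter_drawn[OF assms(1-3)] uv by simp
  qed
  have "path_image (\<gamma> e) \<inter> K A = path_image (\<gamma> e) \<inter> drawn F \<inter> K A" using Ksub by blast
  then have iA: "path_image (\<gamma> e) \<inter> K A = {p s}"
    unfolding ends using pK(1) npK(1) by simp
  have "path_image (\<gamma> e) \<inter> K (- A) = path_image (\<gamma> e) \<inter> drawn F \<inter> K (- A)"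
    using Ksub[of "- A"] by blast
  then have iB: "path_image (\<gamma> e) \<inter> K (- A) = {p t}"
    unfolding ends using pK(2) npK(2) by simp
  have start: "{pathstart (\<gamma> e), pathfinish (\<gamma> e)} = {p s, p t}"
    using ends edge_inter_drawn[OF assms(1-3)] by simp
  have "connected_component (- (drawn F \<union> path_image (\<gamma> e))) a b"
  proof (cases "pathstart (\<gamma> e) = p s")
    case True
    then have "pathfinish (\<gamma> e) = p t"
      using start arc_distinct_ends[OF arc] by (auto simp: doubleton_eq_iff)
    then show ?thesis
      using bridge_keeps_complement_connected[OF arc comp comp disj, unfolded KK] iA iB True ab by simp
  next
    case False
    then have st: "pathstart (\<gamma> e) = p t" "pathfinish (\<gamma> e) = p s"
      using start by (auto simp: doubleton_eq_iff)
    have "K (- A) \<inter> K A = {}" "K (- A) \<union> K A = drawn F" using disj KK by blast+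
    then show ?thesis
      using bridge_keeps_complement_connected[OF arc comp[of "- A"] comp[of A]] iA iB st ab by simp
  qed
  then show ?thesis unfolding drawn_insert .
qed

end

text \<open>
  Faces are counted through representatives: the set \<open>P\<close> has one point in each of \<open>card P\<close> many
  components of the complement of \<open>K\<close>, but need not meet all of them.
\<close>

definition separated_points :: "complex set \<Rightarrow> complex set \<Rightarrow> bool" where
  "separated_points K P \<longleftrightarrow> finite P \<and> P \<inter> K = {} \<and>
    (\<forall>a\<in>P. \<forall>b\<in>P. connected_component (- K) a b \<longrightarrow> a = b)"

text \<open>
  Faces of \<open>S\<close> survive in number when an arc is drawn, since a representative on the arc can be moved
  off it within its face.
\<close>

lemma separated_points_add_arc:
  fixes c :: "real \<Rightarrow> complex"
  assumes P: "separated_points S P" and c: "arc c" "closed S"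
    "path_image c \<inter> S = {pathstart c, pathfinish c}"
  shows "\<exists>Q. separated_points S Q \<and> Q \<inter> path_image c = {} \<and> card Q = card P"
proof -
  have "\<exists>b. b \<notin> S \<union> path_image c \<and> connected_component (- S) a b" if "a \<in> P" for a
  proof -
    have "a \<notin> S" using that P by (auto simp: separated_points_def)
    from face_point_off_arc[OF c this]
    obtain b where "b \<notin> S \<union> path_image c" "connected_component (- S) a b" .
    then show ?thesis by blast
  qed
  then obtain q where q: "\<And>a. a \<in> P \<Longrightarrow> q a \<notin> S \<union> path_image c"
    "\<And>a. a \<in> P \<Longrightarrow> connected_component (- S) a (q a)"
    by metis
  have eq: "a = b" if "a \<in> P" "b \<in> P" "connected_component (- S) (q a) (q b)" for a b
  proof -
    have "connected_component (- S) a b"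
      using q(2)[OF that(1)] q(2)[OF that(2)] that(3)
      by (meson connected_component_sym connected_component_trans)
    then show ?thesis using P that unfolding separated_points_def by blast
  qed
  have "inj_on q P"
  proof (rule inj_onI)
    fix a b assume ab: "a \<in> P" "b \<in> P" "q a = q b"
    have "connected_component (- S) (q a) (q b)"
      using q(1)[OF ab(1)] ab(3) by (simp add: connected_component_refl)
    then show "a = b" by (rule eq[OF ab(1,2)])
  qed
  then have "card (q ` P) = card P" by (rule card_image)
  moreover have "separated_points S (q ` P)"
    unfolding separated_points_def
  proof (intro conjI ballI impI)
    show "finite (q ` P)" using P by (simp add: separated_points_def)
    show "q ` P \<inter> S = {}" using q(1) by auto
    show "a = b" if "a \<in> q ` P" "b \<in> q ` P" "connected_component (- S) a b" for a b
      using that eq by auto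
  qed
  moreover have "q ` P \<inter> path_image c = {}" using q(1) by auto
  ultimately show ?thesis by blast
qed

lemma separated_points_mono:
  assumes "separated_points S P" "S \<subseteq> T" "P \<inter> T = {}"
  shows "separated_points T P"
  using assms connected_component_mono_compl[of T _ _ S] unfolding separated_points_def by blast

text \<open>
  An arc that closes a curve creates a new face: the points \<open>a\<close> and \<open>b\<close> on its two sides replace the
  at most one representative of the face that contains it.
\<close>

lemma separated_points_split:
  fixes c :: "real \<Rightarrow> complex"
  assumes P: "separated_points S P" and c: "arc c" "compact S"
    "path_image c \<inter> S = {pathstart c, pathfinish c}"
    and conn: "path_component S (pathstart c) (pathfinish c)"
  shows "\<exists>Q. separated_points (S \<union> path_image c) Q \<and> card P + 1 \<le> card Q"
proof -
  have clS: "closed S" using c(2) by (rule compact_imp_closed)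
  obtain R where R: "separated_points S R" "R \<inter> path_image c = {}" "card R = card P"
    using separated_points_add_arc[OF P c(1) clS c(3)] by blast
  obtain a b where ab: "a \<notin> S \<union> path_image c" "b \<notin> S \<union> path_image c"
    "connected_component (- S) a b" "\<not> connected_component (- (S \<union> path_image c)) a b"
    using arc_splits_face[OF c conn] .
  \<comment> \<open>Drop the representative of the face that the arc splits.\<close>
  define R' where "R' = {x \<in> R. \<not> connected_component (- S) a x}"
  have finR: "finite R" using R(1) by (simp add: separated_points_def)
  have "R - R' \<subseteq> {x}" if "x \<in> R - R'" for x
  proof
    fix y assume y: "y \<in> R - R'"
    have "connected_component (- S) x y"
      using that y unfolding R'_def
      by (metis (mono_tags, lifting) DiffE connected_component_sym connected_component_trans mem_Collect_eq)
    then show "y \<in> {x}" using R(1) that y unfolding separated_points_def by blast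
  qed
  then have "card (R - R') \<le> 1"
    using finR by (metis card.empty card_mono ex_in_conv finite.intros is_singletonI is_singleton_altdef zero_le)
  moreover have "R' \<subseteq> R" by (auto simp: R'_def)
  ultimately have card: "card R \<le> card R' + 1"
    using finR by (simp add: card_Diff_subset finite_subset)
  have ne: "a \<noteq> b" using ab(1,4) by (metis ComplI connected_component_refl)
  have notin: "a \<notin> R'" "b \<notin> R'"
    using ab(1,3) by (auto simp: R'_def connected_component_refl)
  have finR': "finite R'" using finR by (simp add: R'_def)
  have cardQ: "card ({a, b} \<union> R') = card R' + 2" using ne notin finR' by simp
  have sub: "- (S \<union> path_image c) \<subseteq> - S" by blast
  note lift = connected_component_of_subset[OF _ sub]
  have aR: "\<not> connected_component (- S) a x" "\<not> connected_component (- S) b x" if "x \<in> R'" for x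
    using that ab(3) unfolding R'_def by (auto dest: connected_component_trans)
  have "separated_points (S \<union> path_image c) ({a, b} \<union> R')"
    unfolding separated_points_def
  proof (intro conjI ballI impI)
    show "finite ({a, b} \<union> R')" using finR' by simp
    show "({a, b} \<union> R') \<inter> (S \<union> path_image c) = {}"
      using ab(1,2) R(1,2) by (auto simp: R'_def separated_points_def)
    fix x y assume xy: "x \<in> {a, b} \<union> R'" "y \<in> {a, b} \<union> R'"
      and conn: "connected_component (- (S \<union> path_image c)) x y"
    have S: "connected_component (- S) x y" "connected_component (- S) y x"
      using lift[OF conn] connected_component_sym by blast+
    have T: "connected_component (- (S \<union> path_image c)) y x"
      using conn by (rule connected_component_sym)
    consider "x \<in> {a, b}" "y \<in> {a, b}" | "x \<in> {a, b}" "y \<in> R'" | "x \<in> R'" "y \<in> {a, b}"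
      | "x \<in> R'" "y \<in> R'"
      using xy by blast
    then show "x = y"
    proof cases
      case 1
      then show ?thesis using ab(4) conn T by auto
    next
      case 4
      then show ?thesis using R(1) S unfolding separated_points_def R'_def by blast
    qed (use aR S in auto)
  qed
  then show ?thesis using card cardQ R(3) by (intro exI[of _ "{a, b} \<union> R'"]) simp
qed

context plane_graph begin

text \<open>
  One half of Euler's formula: there are at least \<open>card F - card V + C + 1\<close> faces if the graph with edge
  set \<open>F\<close> has \<open>C\<close> components. The edges are added one by one, and the labelling \<open>r\<close> names the
  components, so \<open>C\<close> is the number of labels: an edge between equal labels
  closes a curve and creates a face, and any other edge merges two labels.
\<close>

lemma face_lower_bound:
  assumes "F \<subseteq> E"
  shows "\<exists>(r :: 'a \<Rightarrow> 'a) P. separated_points (drawn F) P \<and>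
    (\<forall>f\<in>F. \<forall>u\<in>f. \<forall>v\<in>f. r u = r v) \<and>
    (\<forall>u\<in>V. \<forall>v\<in>V. r u = r v \<longrightarrow> path_component (drawn F) (p u) (p v)) \<and>
    card F + card (r ` V) + 1 \<le> card P + card V"
proof -
  have "finite F" using assms finite_E finite_subset by blast
  then show ?thesis using assms
  proof (induction F rule: finite_induct)
    case empty
    have "finite (p ` V)" using finite_V by simp
    then obtain x where x: "x \<notin> p ` V"
      using infinite_UNIV_char_0[where 'a = complex] ex_new_if_finite by blast
    have "path_component (drawn {}) (p u) (p u)" if "u \<in> V" for u
      using that by (intro path_component_refl) (auto simp: drawn_def)
    then show ?case
      using x by (intro exI[of _ id] exI[of _ "{x}"]) (auto simp: separated_points_def drawn_def)
  next
    case (insert e F)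
    then have eE: "e \<in> E" and FE: "F \<subseteq> E" by auto
    obtain r :: "'a \<Rightarrow> 'a" and P where "separated_points (drawn F) P \<and>
      (\<forall>f\<in>F. \<forall>u\<in>f. \<forall>v\<in>f. r u = r v) \<and>
      (\<forall>u\<in>V. \<forall>v\<in>V. r u = r v \<longrightarrow> path_component (drawn F) (p u) (p v)) \<and>
      card F + card (r ` V) + 1 \<le> card P + card V"
      using insert.IH[OF FE] by (elim exE)
    then have P: "separated_points (drawn F) P"
      and mono: "\<And>f u v. f \<in> F \<Longrightarrow> u \<in> f \<Longrightarrow> v \<in> f \<Longrightarrow> r u = r v"
      and conn: "\<And>u v. u \<in> V \<Longrightarrow> v \<in> V \<Longrightarrow> r u = r v \<Longrightarrow> path_component (drawn F) (p u) (p v)"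
      and card: "card F + card (r ` V) + 1 \<le> card P + card V"
      by blast+
    obtain s t where e: "e = {s, t}" "s \<in> V" "t \<in> V" "s \<noteq> t"
      "pathstart (\<gamma> e) = p s" "pathfinish (\<gamma> e) = p t"
      using edge_ends[OF eE] .
    note arc = edge_arc[OF eE] and meet = edge_inter_drawn[OF eE FE \<open>e \<notin> F\<close>]
      and comp = compact_drawn[OF FE]
    have sub: "drawn F \<subseteq> drawn (insert e F)" by (auto simp: drawn_insert)
    have conn': "path_component (drawn (insert e F)) (p u) (p v)"
      if "u \<in> V" "v \<in> V" "r u = r v" for u v
      using conn[OF that] sub by (meson path_component_of_subset)
    have cardF: "card (insert e F) = card F + 1" using insert by simp
    show ?case
    proof (cases "r s = r t")
      case True
      have "path_component (drawn F) (pathstart (\<gamma> e)) (pathfinish (\<gamma> e))"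
        using conn[OF e(2,3) True] e(5,6) by simp
      from separated_points_split[OF P arc comp meet this]
      obtain Q where Q: "separated_points (drawn (insert e F)) Q" "card P + 1 \<le> card Q"
        unfolding drawn_insert by blast
      have "r u = r v" if "f \<in> insert e F" "u \<in> f" "v \<in> f" for f u v
        using that mono[of f u v] e(1) True by auto
      then have mono': "\<forall>f\<in>insert e F. \<forall>u\<in>f. \<forall>v\<in>f. r u = r v" by blast
      show ?thesis
      proof (intro exI conjI)
        show "separated_points (drawn (insert e F)) Q" by (rule Q(1))
        show "\<forall>f\<in>insert e F. \<forall>u\<in>f. \<forall>v\<in>f. r u = r v" by (rule mono')
        show "\<forall>u\<in>V. \<forall>v\<in>V. r u = r v \<longrightarrow> path_component (drawn (insert e F)) (p u) (p v)"
          by (intro ballI impI conn')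
        show "card (insert e F) + card (r ` V) + 1 \<le> card Q + card V"
          using Q(2) card cardF by simp
      qed
    next
      case False
      obtain Q where Q: "separated_points (drawn F) Q" "Q \<inter> path_image (\<gamma> e) = {}" "card Q = card P"
        using separated_points_add_arc[OF P arc compact_imp_closed[OF comp] meet] by blast
      have "Q \<inter> drawn (insert e F) = {}"
        using Q by (auto simp: separated_points_def drawn_insert)
      then have Q': "separated_points (drawn (insert e F)) Q"
        using separated_points_mono[OF Q(1) sub] by blast
      \<comment> \<open>Merge the components of \<open>s\<close> and \<open>t\<close>.\<close>
      define r' where "r' w = (if r w = r t then r s else r w)" for w
      have "r' ` V = r ` V - {r t}"
        using e(2) False by (auto simp: r'_def)
      then have card': "card (r' ` V) + 1 = card (r ` V)"
        using e(3) finite_V by (metis Suc_eq_plus1 card_Suc_Diff1 finite_imageI imageI)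
      have st: "path_component (drawn (insert e F)) (p s) (p t)"
        using e(5,6) arc unfolding path_component_def drawn_insert
        by (intro exI[of _ "\<gamma> e"]) (auto simp: arc_imp_path)
      have conn'': "path_component (drawn (insert e F)) (p u) (p v)"
        if uv: "u \<in> V" "v \<in> V" "r' u = r' v" for u v
      proof -
        have to_s: "path_component (drawn (insert e F)) (p w) (p s)" if "w \<in> V" "r' w = r s" for w
        proof (cases "r w = r t")
          case True
          then show ?thesis using conn'[OF that(1) e(3) True] st
            by (meson path_component_sym path_component_trans)
        next
          case False
          then show ?thesis using conn'[OF that(1) e(2)] that(2) by (simp add: r'_def)
        qed
        show ?thesis
        proof (cases "r' u = r s")
          case True
          then show ?thesis using to_s[OF uv(1)] to_s[OF uv(2)] uv(3)
            by (metis path_component_sym path_component_trans)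
        next
          case False
          then have "r u = r v" using uv(3) by (auto simp: r'_def split: if_splits)
          then show ?thesis using conn' uv by blast
        qed
      qed
      have "r' u = r' v" if "f \<in> insert e F" "u \<in> f" "v \<in> f" for f u v
        using that mono[of f u v] e(1) by (auto simp: r'_def)
      then have mono': "\<forall>f\<in>insert e F. \<forall>u\<in>f. \<forall>v\<in>f. r' u = r' v" by blast
      show ?thesis
      proof (intro exI conjI)
        show "separated_points (drawn (insert e F)) Q" by (rule Q')
        show "\<forall>f\<in>insert e F. \<forall>u\<in>f. \<forall>v\<in>f. r' u = r' v" by (rule mono')
        show "\<forall>u\<in>V. \<forall>v\<in>V. r' u = r' v \<longrightarrow> path_component (drawn (insert e F)) (p u) (p v)"
          by (intro ballI impI conn'')
        show "card (insert e F) + card (r' ` V) + 1 \<le> card Q + card V"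
          using Q(3) card card' cardF by simp
      qed
    qed
  qed
qed

text \<open>
  The face is given by one of its points \<open>a\<close>. The face contains no point of the drawing, so an edge that
  meets its closure meets its frontier. The ends of the arc are left out because a face may touch a
  vertex without being bounded by each edge at this vertex.
\<close>

definition boundary_edges :: "complex \<Rightarrow> 'a set set" where
  "boundary_edges a = {e \<in> E. arc_interior (\<gamma> e) \<inter> closure (connected_component_set (- drawn E) a) \<noteq> {}}"

text \<open>
  All faces that \<open>e\<close> bounds lie in the face of the drawing without \<open>e\<close> that contains the interior of
  \<open>e\<close>. If the ends of \<open>e\<close> are joined in that drawing, then \<open>e\<close> cuts this face into at most two parts, and
  otherwise \<open>e\<close> is a bridge and does not cut it at all. The labels of the preceding lemma decide
  between the two cases and provide the cut for the bridge.
\<close>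

lemma edge_bounds_at_most_two_faces:
  assumes e: "e \<in> E" and P: "separated_points (drawn E) P"
  shows "card {a \<in> P. e \<in> boundary_edges a} \<le> 2"
proof (rule ccontr)
  assume "\<not> ?thesis"
  then have "3 \<le> card {a \<in> P. e \<in> boundary_edges a}" by simp
  from obtain_subset_with_card_n[OF this]
  obtain T where T: "T \<subseteq> {a \<in> P. e \<in> boundary_edges a}" "card T = 3" .
  from T(2) obtain a1 a2 a3 where T3: "T = {a1, a2, a3}" "a1 \<noteq> a2" "a1 \<noteq> a3" "a2 \<noteq> a3"
    by (auto simp: card_3_iff)
  let ?F = "E - {e}"
  have FE: "?F \<subseteq> E" "e \<notin> ?F" by auto
  have ins: "insert e ?F = E" using e by auto
  have E_eq: "drawn E = drawn ?F \<union> path_image (\<gamma> e)" using drawn_insert[of e ?F] unfolding ins .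
  note arc = edge_arc[OF e] and meet = edge_inter_drawn[OF e FE] and comp = compact_drawn[OF FE(1)]
  have int: "arc_interior (\<gamma> e) \<subseteq> - drawn ?F" using meet by (auto simp: arc_interior_def)
  obtain x0 where x0: "x0 \<in> arc_interior (\<gamma> e)" using arc_interior_connected_nonempty(2)[OF arc] by blast
  have near: "connected_component (- drawn ?F) x0 a" if "a \<in> T" for a
  proof -
    let ?f = "connected_component_set (- drawn E) a"
    have "arc_interior (\<gamma> e) \<inter> closure ?f \<noteq> {}" using that T(1) by (auto simp: boundary_edges_def)
    then obtain x where x: "x \<in> arc_interior (\<gamma> e)" "x \<in> closure ?f" by blast
    let ?g = "connected_component_set (- drawn ?F) x"
    have "open ?g" using comp by (simp add: compact_imp_closed open_Compl open_connected_component)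
    moreover have "x \<in> ?g" using x(1) int by (auto intro: connected_component_refl)
    ultimately have "?g \<inter> ?f \<noteq> {}" using x(2) by (meson IntI disjoint_iff open_Int_closure_eq_empty)
    then obtain y where y: "connected_component (- drawn ?F) x y" "connected_component (- drawn E) a y" by auto
    have "connected_component (- drawn ?F) a y"
      using connected_component_mono_compl[OF y(2)] E_eq by blast
    moreover have "connected_component (- drawn ?F) x0 x"
      unfolding connected_component_def
      using arc_interior_connected_nonempty(1)[OF arc] int x0 x(1) by blast
    ultimately show ?thesis using y(1) by (meson connected_component_sym connected_component_trans)
  qed
  have conn: "connected_component (- drawn ?F) a b" if "a \<in> T" "b \<in> T" for a b
    using near[OF that(1)] near[OF that(2)] by (meson connected_component_sym connected_component_trans)
  have off: "a \<notin> path_image (\<gamma> e)" if "a \<in> T" for a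
    using that T(1) P E_eq by (auto simp: separated_points_def)
  have sep: "\<not> connected_component (- drawn E) a b" if "a \<in> T" "b \<in> T" "a \<noteq> b" for a b
    using that T(1) P unfolding separated_points_def by blast
  have a: "a1 \<in> T" "a2 \<in> T" "a3 \<in> T" using T3 by auto
  have not_conn: "\<not> path_component (drawn ?F) (pathstart (\<gamma> e)) (pathfinish (\<gamma> e))"
    using arc_touches_at_most_two_faces[OF arc comp meet _ off[OF a(1)] off[OF a(2)] off[OF a(3)]
        conn[OF a(1,2)] conn[OF a(1,3)]] sep a T3(2-) unfolding E_eq by blast
  from face_lower_bound[OF FE(1)] obtain r :: "'a \<Rightarrow> 'a" and Q where
    "separated_points (drawn ?F) Q \<and> (\<forall>f\<in>?F. \<forall>u\<in>f. \<forall>v\<in>f. r u = r v) \<and>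
      (\<forall>u\<in>V. \<forall>v\<in>V. r u = r v \<longrightarrow> path_component (drawn ?F) (p u) (p v)) \<and>
      card ?F + card (r ` V) + 1 \<le> card Q + card V"
    by (elim exE)
  then have mono: "\<And>f u v. f \<in> ?F \<Longrightarrow> u \<in> f \<Longrightarrow> v \<in> f \<Longrightarrow> r u = r v"
    and rconn: "\<And>u v. u \<in> V \<Longrightarrow> v \<in> V \<Longrightarrow> r u = r v \<Longrightarrow> path_component (drawn ?F) (p u) (p v)"
    by blast+
  obtain s t where st: "e = {s, t}" "s \<in> V" "t \<in> V" "s \<noteq> t"
    "pathstart (\<gamma> e) = p s" "pathfinish (\<gamma> e) = p t"
    using edge_ends[OF e] .
  have rst: "r s \<noteq> r t" using not_conn rconn[OF st(2,3)] st(5,6) by auto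
  have "connected_component (- drawn (insert e ?F)) a1 a2"
  proof (rule cut_edge_keeps_faces[OF e FE _ st(1)])
    show "f \<subseteq> {w. r w = r s} \<or> f \<inter> {w. r w = r s} = {}" if f: "f \<in> ?F" for f
    proof (cases "\<exists>w\<in>f. r w = r s")
      case True
      then obtain w where w: "w \<in> f" "r w = r s" by blast
      have "r v = r s" if "v \<in> f" for v using mono[OF f that w(1)] w(2) by simp
      then show ?thesis by blast
    qed blast
    show "s \<in> {w. r w = r s}" "t \<notin> {w. r w = r s}" using rst by auto
  qed (use conn[OF a(1,2)] off[OF a(1)] off[OF a(2)] in blast)+
  then have "connected_component (- drawn E) a1 a2" unfolding ins .
  then show False using sep[OF a(1,2)] T3(2) by blast
qed

end

section \<open>The number of edges of a bipartite plane graph\<close>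

text \<open>
  A cycle of a bipartite graph has at least four edges. With at most two edges \<open>f\<close>, \<open>g\<close> besides \<open>e\<close>, the
  cut \<open>A\<close> can be taken as \<open>f \<union> g\<close> if these edges share a vertex and as a single edge at a chosen end of
  \<open>e\<close> otherwise, or as this end alone if no other edge reaches it.
\<close>

lemma three_bipartite_edges_have_bridge:
  assumes G: "finite_simple_graph V E" and bip: "bipartite_graph V E"
    and B: "B \<subseteq> E" "card B \<le> 3" "e \<in> B" "finite B"
  shows "\<exists>s t A. e = {s, t} \<and> s \<in> A \<and> t \<notin> A \<and> (\<forall>f\<in>B - {e}. f \<subseteq> A \<or> f \<inter> A = {})"
proof -
  from bip obtain X Y where "X \<union> Y = V \<and> X \<inter> Y = {} \<and> (\<forall>e\<in>E. \<exists>x\<in>X. \<exists>y\<in>Y. e = {x, y})"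
    unfolding bipartite_graph_def by (elim exE)
  then have XY: "X \<inter> Y = {}"
    and bipE: "\<And>e. e \<in> B \<Longrightarrow> \<exists>x\<in>X. \<exists>y\<in>Y. e = {x, y}"
    using B(1) by blast+
  obtain x y where e: "x \<in> X" "y \<in> Y" "e = {x, y}" using bipE[OF B(3)] by blast
  have xy: "x \<noteq> y" using e XY by blast
  have found: ?thesis
    if "\<forall>f\<in>B - {e}. f \<subseteq> A \<or> f \<inter> A = {}" "(x \<in> A) \<noteq> (y \<in> A)" for A
  proof (cases "x \<in> A")
    case True
    then show ?thesis using that e(3) B(3) by blast
  next
    case False
    then have "y \<in> A" "x \<notin> A" "e = {y, x}" using that(2) e(3) by (auto simp: insert_commute)
    then show ?thesis using that(1) B(3) by blast
  qed
  have one: "\<not> (x \<in> f \<and> y \<in> f)" if f: "f \<in> B - {e}" for f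
  proof
    assume in_f: "x \<in> f \<and> y \<in> f"
    obtain x' y' where "x' \<in> X" "y' \<in> Y" "f = {x', y'}" using bipE[of f] f by blast
    then have "f = e" using in_f e XY xy by blast
    then show False using f by blast
  qed
  have none: ?thesis if "\<forall>f\<in>B - {e}. x \<notin> f"
    using found[of "{x}"] that xy by auto
  show ?thesis
  proof (cases "\<exists>f\<in>B - {e}. \<exists>g\<in>B - {e}. f \<noteq> g \<and> f \<inter> g \<noteq> {}")
    case False
    show ?thesis
    proof (cases "\<exists>f\<in>B - {e}. x \<in> f")
      case True
      then obtain f where f: "f \<in> B - {e}" "x \<in> f" by blast
      then have "y \<notin> f" using one by blast
      then show ?thesis using found[of f] f False by blast
    qed (use none in blast)
  next
    case True
    then obtain f g where fg: "f \<in> B - {e}" "g \<in> B - {e}" "f \<noteq> g" "f \<inter> g \<noteq> {}" by blast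
    have "card (B - {e}) \<le> 2" using B by simp
    moreover have "card {f, g} = 2" using fg(3) by simp
    moreover have "finite (B - {e})" using B(4) by simp
    moreover have "{f, g} \<subseteq> B - {e}" using fg by blast
    ultimately have Bfg: "B - {e} = {f, g}" using card_seteq[of "B - {e}" "{f, g}"] by simp
    obtain x1 y1 where f: "x1 \<in> X" "y1 \<in> Y" "f = {x1, y1}" using bipE[of f] fg by blast
    obtain x2 y2 where g: "x2 \<in> X" "y2 \<in> Y" "g = {x2, y2}" using bipE[of g] fg by blast
    have ne: "x1 \<noteq> y2" "x2 \<noteq> y1" "x \<noteq> y1" "x \<noteq> y2" "y \<noteq> x1" "y \<noteq> x2"
      using XY e(1,2) f(1,2) g(1,2) by blast+
    have "x1 = x2 \<or> y1 = y2" using fg(4) f(3) g(3) ne by auto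
    then have "\<not> (x \<in> f \<union> g \<and> y \<in> f \<union> g)"
      using one[OF fg(1)] one[OF fg(2)] f(3) g(3) ne by auto
    moreover have "\<forall>h\<in>B - {e}. h \<subseteq> f \<union> g \<or> h \<inter> (f \<union> g) = {}" unfolding Bfg by blast
    moreover have ?thesis if "x \<notin> f \<union> g" using none that unfolding Bfg by blast
    ultimately show ?thesis using found[of "f \<union> g"] by blast
  qed
qed

context plane_graph begin

lemma three_bipartite_edges_bound_no_face:
  assumes bip: "bipartite_graph V E" and B: "B \<subseteq> E" "card B \<le> 3"
  shows "connected (- drawn B)"
proof -
  have "finite B" using B(1) finite_E finite_subset by blast
  then show ?thesis using B
  proof (induction "card B" arbitrary: B)
    case 0
    then have "drawn B = p ` V" by (simp add: drawn_def)
    then show ?case using connected_compl_finite finite_V by simp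
  next
    case (Suc n)
    then obtain e where eB: "e \<in> B" by fastforce
    obtain s t A where e: "e = {s, t}" "s \<in> A" "t \<notin> A"
      and cut: "\<forall>f\<in>B - {e}. f \<subseteq> A \<or> f \<inter> A = {}"
      using three_bipartite_edges_have_bridge[OF graph bip Suc.prems(2,3) eB Suc.prems(1)] by blast
    have "connected (- drawn (B - {e}))"
      using Suc eB by (intro Suc.hyps(1)) auto
    then have conn: "connected_component (- drawn (B - {e})) a b"
      if "a \<notin> drawn (B - {e})" "b \<notin> drawn (B - {e})" for a b
      using that by (meson ComplI connected_iff_connected_component)
    have ins: "insert e (B - {e}) = B" using eB by auto
    have eE: "e \<in> E" "B - {e} \<subseteq> E" "e \<notin> B - {e}" using eB Suc.prems by auto
    have D: "drawn B = drawn (B - {e}) \<union> path_image (\<gamma> e)"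
      using drawn_insert[of e "B - {e}"] unfolding ins .
    show ?case
      unfolding connected_iff_connected_component
    proof (intro ballI)
      fix a b assume "a \<in> - drawn B" "b \<in> - drawn B"
      then have ab: "a \<notin> drawn (B - {e})" "b \<notin> drawn (B - {e})"
        "a \<notin> path_image (\<gamma> e)" "b \<notin> path_image (\<gamma> e)"
        unfolding D by auto
      show "connected_component (- drawn B) a b"
        using cut_edge_keeps_faces[OF eE _ e conn[OF ab(1,2)] ab(3,4)] cut unfolding ins by blast
    qed
  qed
qed

text \<open>
  If at most three edges bounded the face, then by the preceding lemma they would not separate the
  plane. The frontier of the face is drawn with these edges, so the face would be their whole
  complement, and no room would be left for a further edge.
\<close>

lemma card_boundary_edges_ge_4:
  assumes bip: "bipartite_graph V E" and "4 \<le> card E" and a: "a \<notin> drawn E"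
  shows "4 \<le> card (boundary_edges a)"
proof (rule ccontr)
  assume "\<not> ?thesis"
  then have c3: "card (boundary_edges a) \<le> 3" by simp
  let ?B = "boundary_edges a" and ?f = "connected_component_set (- drawn E) a"
  have BE: "?B \<subseteq> E" by (auto simp: boundary_edges_def)
  have conn: "connected (- drawn ?B)" by (rule three_bipartite_edges_bound_no_face[OF bip BE c3])
  have cl: "closed (drawn E)" using compact_drawn[of E] by (simp add: compact_imp_closed)
  have fE: "?f \<subseteq> - drawn E" by (rule connected_component_subset)
  have "frontier ?f \<subseteq> frontier (- drawn E)" by (rule frontier_of_connected_component_subset)
  then have frE: "frontier ?f \<subseteq> drawn E"
    using frontier_subset_closed[OF cl] unfolding frontier_complement by blast
  have "frontier ?f \<subseteq> drawn ?B"
  proof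
    fix x assume x: "x \<in> frontier ?f"
    show "x \<in> drawn ?B"
    proof (cases "x \<in> p ` V")
      case True
      then show ?thesis by (simp add: drawn_def)
    next
      case False
      then obtain e where e: "e \<in> E" "x \<in> path_image (\<gamma> e)" using x frE by (auto simp: drawn_def)
      obtain u v where "u \<in> V" "v \<in> V" "pathstart (\<gamma> e) = p u" "pathfinish (\<gamma> e) = p v"
        using edge_ends[OF e(1)] .
      then have "x \<in> arc_interior (\<gamma> e)" using e(2) False by (auto simp: arc_interior_def)
      moreover have "x \<in> closure ?f" using x by (simp add: frontier_def)
      ultimately have "e \<in> ?B" using e(1) unfolding boundary_edges_def by blast
      then show ?thesis using e(2) by (auto simp: drawn_def)
    qed
  qed
  moreover have "drawn ?B \<subseteq> drawn E" using BE by (auto simp: drawn_def)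
  moreover have "a \<in> ?f" using a by (simp add: connected_component_refl)
  ultimately have sub: "- drawn ?B \<subseteq> ?f"
    using connected_Int_frontier[OF conn, of ?f] a by blast
  have "?B \<noteq> E" using c3 assms(2) by auto
  then obtain e where e: "e \<in> E" "e \<notin> ?B" using BE by blast
  obtain x where x: "x \<in> arc_interior (\<gamma> e)"
    using arc_interior_connected_nonempty(2)[OF edge_arc[OF e(1)]] by blast
  have "x \<notin> drawn ?B"
    using edge_inter_drawn[OF e(1) BE e(2)] x by (auto simp: arc_interior_def)
  then have "x \<notin> drawn E" using sub fE by blast
  then show False using e(1) x by (auto simp: drawn_def arc_interior_def)
qed

text \<open>
  If there are at least four edges, then double counting the pairs of a face and an edge on its boundary
  shows that there are at least twice as many edges as represented faces, and the lower bound on the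
  number of faces gives the claim.
\<close>

lemma bipartite_card_edges_le:
  assumes bip: "bipartite_graph V E"
  shows "card E \<le> 2 * card V"
proof (cases "4 \<le> card E")
  case False
  show ?thesis
  proof (cases "E = {}")
    case True
    then show ?thesis by simp
  next
    case ne: False
    then obtain e where "e \<in> E" by blast
    then have "e \<subseteq> V" "card e = 2" using graph by (auto simp: finite_simple_graph_def)
    then have "2 \<le> card V" using card_mono[OF finite_V, of e] by simp
    then show ?thesis using False by simp
  qed
next
  case True
  from face_lower_bound[OF order_refl] obtain r :: "'a \<Rightarrow> 'a" and P where
    "separated_points (drawn E) P \<and> (\<forall>f\<in>E. \<forall>u\<in>f. \<forall>v\<in>f. r u = r v) \<and>
      (\<forall>u\<in>V. \<forall>v\<in>V. r u = r v \<longrightarrow> path_component (drawn E) (p u) (p v)) \<and>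
      card E + card (r ` V) + 1 \<le> card P + card V"
    by (elim exE)
  then have P: "separated_points (drawn E) P" and card: "card E + card (r ` V) + 1 \<le> card P + card V"
    by blast+
  have finP: "finite P" and off: "\<And>a. a \<in> P \<Longrightarrow> a \<notin> drawn E"
    using P unfolding separated_points_def by auto
  have bd: "boundary_edges a = {e \<in> E. e \<in> boundary_edges a}" for a
    by (auto simp: boundary_edges_def)
  have "4 * card P = (\<Sum>a\<in>P. 4)" by simp
  also have "\<dots> \<le> (\<Sum>a\<in>P. card {e \<in> E. e \<in> boundary_edges a})"
    using card_boundary_edges_ge_4[OF bip True off] bd by (intro sum_mono) simp
  also have "\<dots> = (\<Sum>e\<in>E. card {a \<in> P. e \<in> boundary_edges a})"
    using finP finite_E by (rule sum_multicount_gen) simp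
  also have "\<dots> \<le> (\<Sum>e\<in>E. 2)"
    by (intro sum_mono edge_bounds_at_most_two_faces P)
  also have "\<dots> = 2 * card E" by simp
  finally show ?thesis using card by simp
qed

end

lemma bipartite_planar_card_edges_le:
  assumes G: "finite_simple_graph V E" and "bipartite_graph V E" and "planar_graph V E" and "W \<subseteq> V"
  shows "card {e \<in> E. e \<subseteq> W} \<le> 2 * card W"
proof -
  let ?F = "{e \<in> E. e \<subseteq> W}"
  obtain p \<gamma> where d: "plane_drawing V E p \<gamma>" using assms(3) by (auto simp: planar_graph_def)
  have d: "inj_on p V"
    "\<forall>e\<in>E. arc (\<gamma> e) \<and> {pathstart (\<gamma> e), pathfinish (\<gamma> e)} = p ` e"
    "\<forall>e\<in>E. arc_interior (\<gamma> e) \<inter> p ` V = {}"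
    "\<forall>e\<in>E. \<forall>f\<in>E. e \<noteq> f \<longrightarrow> arc_interior (\<gamma> e) \<inter> path_image (\<gamma> f) = {}"
    using d unfolding plane_drawing_def by simp_all
  have "plane_drawing W ?F p \<gamma>"
    unfolding plane_drawing_def
  proof (intro conjI ballI impI)
    show "inj_on p W" using d(1) assms(4) by (rule inj_on_subset)
    fix e assume "e \<in> ?F"
    then have e: "e \<in> E" by simp
    show "arc (\<gamma> e)" "{pathstart (\<gamma> e), pathfinish (\<gamma> e)} = p ` e"
      using bspec[OF d(2) e] by simp_all
    show "arc_interior (\<gamma> e) \<inter> p ` W = {}" using bspec[OF d(3) e] assms(4) by blast
    show "arc_interior (\<gamma> e) \<inter> path_image (\<gamma> f) = {}" if "f \<in> ?F" "e \<noteq> f" for f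
      using d(4) e that by simp
  qed
  moreover have "finite_simple_graph W ?F"
    using G assms(4) by (auto simp: finite_simple_graph_def intro: finite_subset)
  ultimately interpret plane_graph W ?F p \<gamma> by unfold_locales
  from assms(2) obtain X Y where XY: "X \<union> Y = V \<and> X \<inter> Y = {} \<and> (\<forall>e\<in>E. \<exists>x\<in>X. \<exists>y\<in>Y. e = {x, y})"
    unfolding bipartite_graph_def by (elim exE)
  have "bipartite_graph W ?F"
    unfolding bipartite_graph_def
  proof (intro exI conjI ballI)
    show "X \<inter> W \<union> Y \<inter> W = W" "X \<inter> W \<inter> (Y \<inter> W) = {}" using XY assms(4) by blast+
    fix e assume "e \<in> ?F"
    moreover from this obtain x y where "x \<in> X" "y \<in> Y" "e = {x, y}" using XY by blast
    ultimately show "\<exists>x\<in>X \<inter> W. \<exists>y\<in>Y \<inter> W. e = {x, y}" by auto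
  qed
  then show ?thesis by (rule bipartite_card_edges_le)
qed

section \<open>The proper orientation number\<close>

theorem corollary1p3:
  fixes V :: "'a set" and E :: "'a set set"
  assumes "finite_simple_graph V E"
    and "bipartite_graph V E"
    and "planar_graph V E"
  shows "proper_orientation_number V E \<le> 5"
proof -
  obtain D0 where D0: "orientation E D0" "\<forall>v\<in>V. outdeg D0 v \<le> 2"
    using orientation_outdeg_le_of_sparse[OF assms(1), of 2] bipartite_planar_card_edges_le[OF assms]
    by blast
  obtain D where D: "proper_orientation E D" "\<forall>v\<in>V. outdeg D v \<le> 5"
    using bipartite_proper_orientation_le[OF assms(1,2) D0] by auto
  have "proper_orientation_number V E \<le> (SUP v \<in> V. outdeg D v)"
    unfolding proper_orientation_number_def
    by (rule cINF_lower) (use D(1) in auto)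
  also have "\<dots> \<le> 5"
  proof (cases "V = {}")
    case True
    then show ?thesis by simp
  next
    case False
    then show ?thesis using D(2) by (intro cSUP_least) auto
  qed
  finally show ?thesis .
qed

end
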